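(* Let $d \geq 2$. For each $p \in \mathcal{P}$ such that the asymptotic shape $B_{\mu_p} = \{x \in \mathbb{R}^d : \mu_p(x) \leq 1\}$ is compact, we have $$\lim_{q \to p} d_H\left(B_{\mu_p}, B_{\mu_q}\right) = 0,$$ where $q \to p$ in $\mathcal{P}$.
   Context: Let $\mathcal{P} = \{(p_1,p_2,\ldots) \in [0,1]^{\mathbb{N}^*} : \sum_{i \geq 1} p_i = 1\}$, where $\mathbb{N}^*=\{1,2,\ldots\}$. The $L_1$-norm $\|\cdot\|_1$, the supremum norm $|p| = \sup_i p_i$ and pointwise convergence induce the same topology on $\mathcal{P}$; this is the topology used on $\mathcal{P}$. Fix $d\ge 2$. $\mathbb{Z}^d$ is endowed with the set of edges $\mathbb{E}^d$ of all pairs $\{u,v\}$ with $u,v\in\mathbb{Z}^d$, $\|u-v\|_1 = 1$. For $p \in \mathcal{P}$, let $(X_u)_{u \in \mathbb{Z}^d}$ be i.i.d. with law $\sum_{i\geq 1} p_i \delta_i$ (a random coloring). Each edge $\{u,v\}$ gets the passage time $t(\{u,v\}) = \mathbf{1}_{\{X_u \neq X_v\}}$. A path $\gamma$ is a finite nearest-neighbour sequence of vertices (together with the edges between consecutive ones), and its passage time $T(\gamma)$ is the sum of $t(e)$ over its successive edges. For $u,v \in \mathbb{Z}^d$, $T_p(u,v)$ is the infimum of $T(\gamma)$ over all paths $\gamma$ from $u$ to $v$. For $x,y \in \mathbb{R}^d$, $T_p(x,y) := T_p(x^\star, y^\star)$, where $x^\star$ is the site of $\mathbb{Z}^d$ nearest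 to $x$ (ties broken by a deterministic rule). For each $p\in\mathcal{P}$ and $x \in \mathbb{R}^d$, it is known that there is a constant $\mu_p(x)$ such that $\lim_{n\to\infty} T_p(0,nx)/n = \mu_p(x)$ almost surely, and that $\mu_p$ is a seminorm on $\mathbb{R}^d$. This defines $\mu_p$. For non-empty compact subsets $X,Y$ of a metric space $(E,\mathrm{d})$ (here $\mathbb{R}^d$ with the distance given by a norm, e.g. the Euclidean one), the Hausdorff distance is $d_H(X,Y) = \max\{\sup_{y\in Y}\inf_{x\in X} \mathrm{d}(x,y), \ \sup_{x \in X}\inf_{y\in Y} \mathrm{d}(x,y)\}$. It is known (Fontes and Newman) that $B_{\mu_p}$ is compact if and only if $|p| < p_c$, where $p_c$ is the critical probability of Bernoulli site percolation on $\mathbb{Z}^d$; in particular, if $B_{\mu_p}$ is compact, then so is $B_{\mu_q}$ for all $q$ in a neighbourhood of $p$. *)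

theory Defs
  imports "HOL-Probability.Probability"
begin

text \<open>
  Colours are labelled by \<open>0, 1, 2, \<dots>\<close> instead of \<open>1, 2, 3, \<dots>\<close>.  The topology on
  \<open>color_simplex\<close> is the trace of the product topology that \<^theory>\<open>HOL-Analysis.Function_Topology\<close>
  puts on \<^typ>\<open>nat \<Rightarrow> real\<close>, i.e. that of pointwise convergence.
\<close>

definition color_simplex :: "(nat \<Rightarrow> real) set" where
  "color_simplex = {p. (\<forall>i. p i \<in> {0..1}) \<and> p sums 1}"

text \<open>The law of an i.i.d. colouring of \<open>\<int>\<^sup>d\<close>, \<open>d = CARD('n)\<close>, on its canonical space.\<close>

definition coloring_law :: "(nat \<Rightarrow> real) \<Rightarrow> ((int ^ 'n::finite) \<Rightarrow> nat) measure" where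
  "coloring_law p = (\<Pi>\<^sub>M u\<in>UNIV. measure_pmf (embed_pmf p))"

definition adjacent :: "int ^ 'n::finite \<Rightarrow> int ^ 'n \<Rightarrow> bool" where
  "adjacent u v \<longleftrightarrow> (\<Sum>i\<in>UNIV. \<bar>u $ i - v $ i\<bar>) = 1"

definition paths :: "int ^ 'n::finite \<Rightarrow> int ^ 'n \<Rightarrow> (int ^ 'n) list set" where
  "paths u v = {\<gamma>. \<gamma> \<noteq> [] \<and> hd \<gamma> = u \<and> last \<gamma> = v \<and>
     (\<forall>k. Suc k < length \<gamma> \<longrightarrow> adjacent (\<gamma> ! k) (\<gamma> ! Suc k))}"

definition edge_time :: "('v \<Rightarrow> nat) \<Rightarrow> 'v \<Rightarrow> 'v \<Rightarrow> nat" where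
  "edge_time X u v = (if X u \<noteq> X v then 1 else 0)"

definition path_time :: "('v \<Rightarrow> nat) \<Rightarrow> 'v list \<Rightarrow> nat" where
  "path_time X \<gamma> = (\<Sum>k<length \<gamma> - 1. edge_time X (\<gamma> ! k) (\<gamma> ! Suc k))"

definition passage_time :: "((int ^ 'n::finite) \<Rightarrow> nat) \<Rightarrow> int ^ 'n \<Rightarrow> int ^ 'n \<Rightarrow> nat" where
  "passage_time X u v = (INF \<gamma>\<in>paths u v. path_time X \<gamma>)"

definition site_vec :: "int ^ 'n::finite \<Rightarrow> real ^ 'n" where
  "site_vec u = (\<chi> i. real_of_int (u $ i))"

text \<open>A map \<open>x \<mapsto> x\<^sup>\<star>\<close> to a nearest site; the choice of the map is the tie-breaking rule.\<close>

definition nearest_site_rule :: "(real ^ 'n::finite \<Rightarrow> int ^ 'n) \<Rightarrow> bool" where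
  "nearest_site_rule s \<longleftrightarrow> (\<forall>x u. dist x (site_vec (s x)) \<le> dist x (site_vec u))"

definition time_constant ::
  "(real ^ 'n::finite \<Rightarrow> int ^ 'n) \<Rightarrow> (nat \<Rightarrow> real) \<Rightarrow> real ^ 'n \<Rightarrow> real" where
  "time_constant s p x = (THE m. AE X in coloring_law p.
     (\<lambda>n. real (passage_time X (s 0) (s (real n *\<^sub>R x))) / real n) \<longlonglongrightarrow> m)"

definition asymptotic_shape ::
  "(real ^ 'n::finite \<Rightarrow> int ^ 'n) \<Rightarrow> (nat \<Rightarrow> real) \<Rightarrow> (real ^ 'n) set" where
  "asymptotic_shape s p = {x. time_constant s p x \<le> 1}"

text \<open>
  The values are taken in \<^typ>\<open>ennreal\<close> so that the suprema are meaningful for arbitrary sets;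
  for non-empty compact sets they are finite.
\<close>

definition hausdorff_dist :: "'a::metric_space set \<Rightarrow> 'a set \<Rightarrow> ennreal" where
  "hausdorff_dist A B =
     max (SUP y\<in>B. INF x\<in>A. ennreal (dist x y)) (SUP x\<in>A. INF y\<in>B. ennreal (dist x y))"

lemma pmf_embed_color_simplex:
  assumes "p \<in> color_simplex"
  shows "pmf (embed_pmf p) i = p i"
proof (rule pmf_embed_pmf)
  have p: "\<And>i. 0 \<le> p i" "p sums 1"
    using assms by (auto simp: color_simplex_def)
  show "\<And>i. 0 \<le> p i" by (fact p)
  have "(\<integral>\<^sup>+ i. ennreal (p i) \<partial>count_space UNIV) = (\<Sum>i. ennreal (p i))"
    by (rule nn_integral_count_space_nat)
  also have "\<dots> = ennreal (\<Sum>i. p i)"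
    using p by (intro suminf_ennreal2) (auto simp: sums_iff)
  finally show "(\<integral>\<^sup>+ i. ennreal (p i) \<partial>count_space UNIV) = 1"
    using p by (simp add: sums_iff)
qed

lemma nearest_site_rule_round:
  "nearest_site_rule (\<lambda>x::real ^ 'n::finite. \<chi> i. round (x $ i))"
  unfolding nearest_site_rule_def dist_vec_def
  by (intro allI L2_set_mono)
     (simp_all add: site_vec_def dist_real_def abs_minus_commute round_diff_minimal)

end

theory Submission
  imports Defs
begin

text \<open>
  Let \<open>rate P x\<close> be the limit of the expectations of \<open>T(0, n x) / n\<close>, which exists by subadditivity.
  It is subadditive, positively homogeneous and Lipschitz in \<open>x\<close>.  The theorem follows from three facts
  about it.

  First, \<open>T(0, n x) / n\<close> almost surely does not exceed \<open>rate P x\<close> in the limit (\<open>upper_tail\<close>): a path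
  to a far multiple of a site can be glued from pieces that use finitely many sites each, and
  Hoeffding's inequality applies to the times of these pieces.  As \<open>n rate P x\<close> is, up to a bounded error,
  a lower bound for the expectation of \<open>T(0, n x)\<close>, this forces convergence in probability (\<open>lower_deviation_prob\<close>).

  Second, if \<open>f = rate P\<close> is positive away from \<open>0\<close>, a renormalisation argument (\<open>lower_bound\<close>) shows
  that \<open>(1 + \<theta>) T(0, w) \<ge> f w - K\<close> for all \<open>w\<close> with a random constant \<open>K\<close>.  Divide the lattice into cubes
  of side \<open>N\<close> and follow a geodesic from cube to cube, always \<open>M\<close> cubes further.  A cube is good if such a
  crossing takes about as long as \<open>f\<close> predicts.  Good cubes make the geodesic pay both for its number of
  steps and for the distance covered in the sense of \<open>f\<close>; the bad ones do little harm because they form a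
  small proportion of every long chain of distinct cubes (\<open>few_bad_cells\<close>, a union bound over chains).
  All that enters about the law of the colouring is that a cube is bad with small probability.
  For the law \<open>P\<close> itself this probability tends to \<open>0\<close> as \<open>N\<close> grows, by convergence in probability, and it
  follows that \<open>T(0, n x) / n\<close> converges to the rate almost surely: the time constant is the rate.

  Third, being bad is decided by finitely many sites, so for fixed \<open>N\<close> its probability remains small under
  any law close to \<open>P\<close>.  The same lower bound, with the same \<open>f\<close>, thus holds under the law of \<open>q\<close> for \<open>q\<close>
  near \<open>p\<close>, and comparison with the upper tail under that law gives
  \<open>rate p \<le> (1 + \<theta>) rate q\<close>.  The opposite inequality is easier, the rate being an infimum of expectations
  that are upper semicontinuous in the law; compactness of the sphere makes it uniform in the direction.

  Compactness of the shape enters through the positivity of the rate: where the rate vanishes the upper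
  tail alone identifies the time constant as \<open>0\<close>, and the shape would contain a whole half-line.
  Two unit balls of gauges that agree up to the factor \<open>1 + \<theta>\<close> are close in Hausdorff distance.
\<close>

section \<open>Paths and passage times\<close>

definition l1norm :: "real ^ 'n::finite \<Rightarrow> real" where
  "l1norm x = (\<Sum>i\<in>UNIV. \<bar>x $ i\<bar>)"

lemma site_vec_simps [simp]:
  "site_vec 0 = 0" "site_vec (u + v) = site_vec u + site_vec v"
  "site_vec (u - v) = site_vec u - site_vec v" "site_vec (- u) = - site_vec u"
  "site_vec (of_int k *s u) = of_int k *\<^sub>R site_vec u"
  by (simp_all add: site_vec_def vec_eq_iff)

lemma l1norm_nonneg [simp]: "0 \<le> l1norm x"
  by (simp add: l1norm_def sum_nonneg)

lemma l1norm_triangle: "l1norm (x + y) \<le> l1norm x + l1norm y"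
  by (simp add: l1norm_def sum.distrib [symmetric] sum_mono)

lemma l1norm_minus_commute: "l1norm (x - y) = l1norm (y - x)"
  by (simp add: l1norm_def abs_minus_commute)

lemma l1norm_scale: "l1norm (a *\<^sub>R x) = \<bar>a\<bar> * l1norm x"
  by (simp add: l1norm_def abs_mult sum_distrib_left)

lemma l1norm_0 [simp]: "l1norm 0 = 0"
  by (simp add: l1norm_def)

lemma l1norm_triangle_diff: "l1norm (x - z) \<le> l1norm (x - y) + l1norm (y - z)"
  using l1norm_triangle[of "x - y" "y - z"] by simp

lemma l1norm_le:
  assumes "\<And>i. \<bar>x $ i\<bar> \<le> C"
  shows "l1norm (x :: real ^ 'n::finite) \<le> real CARD('n) * C"
  using sum_bounded_above[of UNIV "\<lambda>i. \<bar>x $ i\<bar>" C] assms by (simp add: l1norm_def)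

lemma component_le_l1norm: "\<bar>x $ i\<bar> \<le> l1norm x"
  unfolding l1norm_def by (rule member_le_sum) auto

lemma norm_le_l1norm: "norm x \<le> l1norm x"
  unfolding l1norm_def by (rule norm_le_l1_cart)

lemma l1norm_le_norm: "l1norm (x :: real ^ 'n::finite) \<le> real CARD('n) * norm x"
  by (rule l1norm_le) (rule component_le_norm_cart)

lemma paths_iff:
  "\<gamma> \<in> paths u v \<longleftrightarrow> \<gamma> \<noteq> [] \<and> hd \<gamma> = u \<and> last \<gamma> = v \<and> successively adjacent \<gamma>"
  by (auto simp: paths_def successively_conv_nth)

lemma path_time_singleton [simp]: "path_time X [v] = 0"
  by (simp add: path_time_def)

lemma path_time_Cons [simp]:
  "path_time X (a # b # \<gamma>) = edge_time X a b + path_time X (b # \<gamma>)"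
  unfolding path_time_def by (simp add: sum.lessThan_Suc_shift del: sum.lessThan_Suc)

lemma path_time_append:
  "path_time X (\<alpha> @ v # \<beta>) = path_time X (\<alpha> @ [v]) + path_time X (v # \<beta>)"
proof (induction \<alpha>)
  case (Cons a \<alpha>)
  then show ?case by (cases \<alpha>) auto
qed simp

lemma paths_concat:
  assumes "\<alpha> @ [v] \<in> paths u v" "v # \<beta> \<in> paths v w"
  shows "\<alpha> @ v # \<beta> \<in> paths u w"
proof (cases "\<alpha> = []")
  case False
  then show ?thesis
    using assms by (auto simp: paths_iff successively_append_iff)
qed (use assms in \<open>auto simp: paths_iff\<close>)

text \<open>
  Moving one coordinate at a time reaches \<open>v\<close> in as many steps as the \<open>l\<^sup>1\<close>-distance.  This gives
  passage times a deterministic Lipschitz property, through which every change of end points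
  below is controlled.
\<close>

lemma ex_path_le_l1:
  "\<exists>\<gamma>\<in>paths u v. real (path_time X \<gamma>) \<le> l1norm (site_vec u - site_vec v)"
proof (induction "nat (\<Sum>i\<in>UNIV. \<bar>u $ i - v $ i\<bar>)" arbitrary: u)
  case 0
  then have "(\<Sum>i\<in>UNIV. \<bar>u $ i - v $ i\<bar>) = 0"
    by (simp add: order_antisym sum_nonneg)
  then have "u = v"
    by (subst (asm) sum_nonneg_eq_0_iff) (auto simp: vec_eq_iff)
  then show ?case by (intro bexI[of _ "[v]"]) (auto simp: paths_iff)
next
  case (Suc m u)
  have "u \<noteq> v" using Suc.hyps(2) by auto
  then obtain i where i: "u $ i \<noteq> v $ i" by (auto simp: vec_eq_iff)
  define u' where "u' = (\<chi> j. if j = i then u $ i + sgn (v $ i - u $ i) else u $ j)"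
  have u'j: "u' $ j = u $ j" if "j \<noteq> i" for j using that by (simp add: u'_def)
  have u'i: "\<bar>u $ i - v $ i\<bar> = 1 + \<bar>u' $ i - v $ i\<bar>" "\<bar>u $ i - u' $ i\<bar> = 1"
    using i by (auto simp: u'_def sgn_if)
  have split: "(\<Sum>j\<in>UNIV. g j) = g i + (\<Sum>j\<in>UNIV - {i}. g j)" for g :: "'a \<Rightarrow> int"
    by (rule sum.remove) auto
  have sum1: "(\<Sum>j\<in>UNIV. \<bar>u $ j - v $ j\<bar>) = 1 + (\<Sum>j\<in>UNIV. \<bar>u' $ j - v $ j\<bar>)"
    by (subst (1 2) split) (simp add: u'i u'j)
  have adj: "adjacent u u'"
    unfolding adjacent_def by (subst split) (simp add: u'i u'j)
  obtain \<gamma> where \<gamma>: "\<gamma> \<in> paths u' v" "real (path_time X \<gamma>) \<le> l1norm (site_vec u' - site_vec v)"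
    using Suc.hyps(1)[of u'] Suc.hyps(2) sum1 sum_nonneg[of UNIV "\<lambda>j. \<bar>u' $ j - v $ j\<bar>"]
    by (smt (verit) Suc_nat_eq_nat_zadd1 abs_ge_zero nat.inject)
  obtain \<beta> where \<beta>: "\<gamma> = u' # \<beta>"
    using \<gamma>(1) by (cases \<gamma>) (auto simp: paths_iff)
  have l1: "l1norm (site_vec u - site_vec v) = of_int (\<Sum>j\<in>UNIV. \<bar>u $ j - v $ j\<bar>)" for u
    by (simp add: l1norm_def site_vec_def)
  have "path_time X (u # \<gamma>) \<le> 1 + path_time X \<gamma>"
    by (simp add: \<beta> edge_time_def)
  then have "real (path_time X (u # \<gamma>)) \<le> l1norm (site_vec u - site_vec v)"
    using \<gamma>(2) sum1 unfolding l1 by linarith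
  moreover have "u # \<gamma> \<in> paths u v"
    using \<gamma>(1) adj by (auto simp: paths_iff \<beta>)
  ultimately show ?case by blast
qed

lemma passage_time_le: "\<gamma> \<in> paths u v \<Longrightarrow> passage_time X u v \<le> path_time X \<gamma>"
  unfolding passage_time_def by (rule cINF_lower) auto

lemma geodesic_exists:
  obtains \<gamma> where "\<gamma> \<in> paths u v" "path_time X \<gamma> = passage_time X u v"
proof -
  have "path_time X ` paths u v \<noteq> {}"
    using ex_path_le_l1[of u v X] by auto
  from Inf_nat_def1[OF this] show thesis
    using that by (auto simp: passage_time_def)
qed

lemma passage_time_le_l1: "real (passage_time X u v) \<le> l1norm (site_vec u - site_vec v)"
proof -
  obtain \<gamma> where "\<gamma> \<in> paths u v" "real (path_time X \<gamma>) \<le> l1norm (site_vec u - site_vec v)"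
    using ex_path_le_l1[of u v X] by blast
  then show ?thesis
    using passage_time_le[of \<gamma> u v X] by linarith
qed

lemma passage_time_self [simp]: "passage_time X u u = 0"
  using passage_time_le_l1[of X u u] by simp

lemma passage_time_triangle: "passage_time X u w \<le> passage_time X u v + passage_time X v w"
proof -
  obtain \<alpha> where \<alpha>: "\<alpha> \<in> paths u v" "path_time X \<alpha> = passage_time X u v"
    by (rule geodesic_exists)
  obtain \<beta> where \<beta>: "\<beta> \<in> paths v w" "path_time X \<beta> = passage_time X v w"
    by (rule geodesic_exists)
  obtain \<alpha>' where \<alpha>': "\<alpha> = \<alpha>' @ [v]"
    using \<alpha>(1) by (cases \<alpha> rule: rev_cases) (auto simp: paths_iff)
  obtain \<beta>' where \<beta>': "\<beta> = v # \<beta>'"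
    using \<beta>(1) by (cases \<beta>) (auto simp: paths_iff)
  have "passage_time X u w \<le> path_time X (\<alpha>' @ v # \<beta>')"
    using \<alpha>(1) \<beta>(1) unfolding \<alpha>' \<beta>' by (intro passage_time_le) (rule paths_concat)
  then show ?thesis
    using \<alpha>(2) \<beta>(2) unfolding \<alpha>' \<beta>' by (simp add: path_time_append[of X \<alpha>' v \<beta>'])
qed

lemma passage_time_lipschitz:
  "real (passage_time X u v) \<le> real (passage_time X u' v')
     + l1norm (site_vec u - site_vec u') + l1norm (site_vec v - site_vec v')"
proof -
  have "passage_time X u v \<le> passage_time X u u' + (passage_time X u' v' + passage_time X v' v)"
    using passage_time_triangle[of X u v u'] passage_time_triangle[of X u' v v'] by linarith
  then show ?thesis
    using passage_time_le_l1[of X u u'] passage_time_le_l1[of X v' v]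
    by (simp add: l1norm_minus_commute[of "site_vec v"])
qed

definition shift :: "int ^ 'n::finite \<Rightarrow> (int ^ 'n \<Rightarrow> 'c) \<Rightarrow> int ^ 'n \<Rightarrow> 'c" where
  "shift a X = (\<lambda>u. X (u + a))"

lemma path_time_shift: "path_time (shift a X) \<gamma> = path_time X (map (\<lambda>u. u + a) \<gamma>)"
  unfolding path_time_def by (auto simp: edge_time_def shift_def intro!: sum.cong)

lemma adjacent_translate [simp]: "adjacent (u + a) (v + a) \<longleftrightarrow> adjacent u v"
  by (simp add: adjacent_def)

lemma successively_adjacent_translate [simp]:
  "successively adjacent (map (\<lambda>u. u + a) \<gamma>) \<longleftrightarrow> successively adjacent \<gamma>"
  by (simp add: successively_map)

lemma paths_translate: "map (\<lambda>u. u + a) \<gamma> \<in> paths (u + a) (v + a) \<longleftrightarrow> \<gamma> \<in> paths u v"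
  by (auto simp: paths_iff last_map hd_map)

lemma passage_time_shift: "passage_time (shift a X) u v = passage_time X (u + a) (v + a)"
proof (rule antisym)
  obtain \<gamma> where \<gamma>: "\<gamma> \<in> paths (u + a) (v + a)" "path_time X \<gamma> = passage_time X (u + a) (v + a)"
    by (rule geodesic_exists)
  define \<gamma>' where "\<gamma>' = map (\<lambda>u. u - a) \<gamma>"
  have \<gamma>': "\<gamma> = map (\<lambda>u. u + a) \<gamma>'" by (simp add: \<gamma>'_def comp_def)
  show "passage_time (shift a X) u v \<le> passage_time X (u + a) (v + a)"
    using passage_time_le[of \<gamma>' u v "shift a X"] \<gamma> by (simp add: path_time_shift \<gamma>' paths_translate)
next
  obtain \<gamma> where \<gamma>: "\<gamma> \<in> paths u v" "path_time (shift a X) \<gamma> = passage_time (shift a X) u v"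
    by (rule geodesic_exists)
  show "passage_time X (u + a) (v + a) \<le> passage_time (shift a X) u v"
    using passage_time_le[of "map (\<lambda>u. u + a) \<gamma>" "u + a" "v + a" X] \<gamma>
    by (simp add: path_time_shift paths_translate)
qed

section \<open>The law of the colouring\<close>

abbreviation color_law :: "nat pmf \<Rightarrow> ((int ^ 'n::finite) \<Rightarrow> nat) measure" where
  "color_law P \<equiv> (\<Pi>\<^sub>M u\<in>UNIV. measure_pmf P)"

lemma prob_space_color_law: "prob_space (color_law P)"
  by (intro prob_space_PiM measure_pmf.prob_space_axioms)

interpretation color_law: prob_space "color_law P"
  by (rule prob_space_color_law)

lemma space_color_law [simp]: "space (color_law P) = UNIV"
  by (simp add: space_PiM)

lemma prob_color_law_UNIV [simp]: "measure (color_law P) UNIV = 1"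
  using color_law.prob_space[of P] by simp

lemma measurable_color [measurable]:
  "(\<lambda>X. X u) \<in> measurable (color_law P) (count_space UNIV)"
  using measurable_component_singleton[of u UNIV "\<lambda>_. measure_pmf P"] by simp

lemma measurable_edge_time [measurable]:
  "(\<lambda>X. edge_time X u v) \<in> measurable (color_law P) (count_space UNIV)"
proof -
  have "(\<lambda>X. (if (X u, X v) \<in> {z. fst z \<noteq> snd z} then 1 else 0 :: nat))
      \<in> measurable (color_law P) (count_space UNIV)"
    by measurable
  then show ?thesis by (simp add: edge_time_def)
qed

lemma measurable_path_time [measurable]:
  "(\<lambda>X. path_time X \<gamma>) \<in> measurable (color_law P) (count_space UNIV)"
  unfolding path_time_def by measurable

lemma measurable_passage_time [measurable]:
  "(\<lambda>X. passage_time X u v) \<in> measurable (color_law P) (count_space UNIV)"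
proof -
  have "{X. passage_time X u v = k} \<in> sets (color_law P)" for k
  proof -
    have "{X \<in> space (color_law P). (\<exists>\<gamma>. \<gamma> \<in> paths u v \<and> path_time X \<gamma> = k) \<and>
        (\<forall>\<gamma>. \<gamma> \<in> paths u v \<longrightarrow> k \<le> path_time X \<gamma>)} \<in> sets (color_law P)"
      by measurable
    also have "{X \<in> space (color_law P). (\<exists>\<gamma>. \<gamma> \<in> paths u v \<and> path_time X \<gamma> = k) \<and>
        (\<forall>\<gamma>. \<gamma> \<in> paths u v \<longrightarrow> k \<le> path_time X \<gamma>)} = {X. passage_time X u v = k}"
      using passage_time_le geodesic_exists
      by (auto intro!: antisym) (metis order_antisym passage_time_le geodesic_exists)+
    finally show ?thesis .
  qed
  then show ?thesis
    by (subst measurable_count_space_eq2_countable) (auto simp: vimage_def)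
qed

lemma integrable_bounded:
  fixes f :: "((int ^ 'n::finite) \<Rightarrow> nat) \<Rightarrow> real"
  assumes "f \<in> borel_measurable (color_law P)" "\<And>X. \<bar>f X\<bar> \<le> C"
  shows "integrable (color_law P) f"
  using assms by (intro color_law.integrable_const_bound[of _ C]) auto

lemma integrable_passage_time [simp]:
  "integrable (color_law P) (\<lambda>X. real (passage_time X u v))"
  using passage_time_le_l1[of _ u v] by (intro integrable_bounded[where C="l1norm (site_vec u - site_vec v)"]) auto

lemma measurable_shift [measurable]: "shift a \<in> measurable (color_law P) (color_law P)"
  unfolding shift_def by (intro measurable_PiM_single') auto

lemma distr_shift: "distr (color_law P) (color_law P) (shift a) = color_law P"
  using distr_PiM_reindex[of UNIV "\<lambda>_. measure_pmf P" "\<lambda>u. u + a" UNIV]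
  by (simp add: measure_pmf.prob_space_axioms shift_def [abs_def] restrict_def)

lemma integral_shift:
  fixes f :: "((int ^ 'n::finite) \<Rightarrow> nat) \<Rightarrow> real"
  assumes [measurable]: "f \<in> borel_measurable (color_law P)"
  shows "(\<integral>X. f (shift a X) \<partial>color_law P) = (\<integral>X. f X \<partial>color_law P)"
  using integral_distr[of "shift a" "color_law P" "color_law P" f] by (simp add: distr_shift)

lemma prob_shift:
  assumes [measurable]: "A \<in> sets (color_law P)"
  shows "measure (color_law P) {X. shift a X \<in> A} = measure (color_law P) A"
  using measure_distr[of "shift a" "color_law P" "color_law P" A]
  by (simp add: distr_shift vimage_def)

text \<open>
  Independence and continuity in the law are both used for functions of the colours in a
  prescribed set of sites.
\<close>

definition depends_on :: "'v set \<Rightarrow> (('v \<Rightarrow> 'c) \<Rightarrow> 'b) \<Rightarrow> bool" where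
  "depends_on J f \<longleftrightarrow> (\<forall>X Y. (\<forall>u\<in>J. X u = Y u) \<longrightarrow> f X = f Y)"

lemma depends_onD: "depends_on J f \<Longrightarrow> (\<And>u. u \<in> J \<Longrightarrow> X u = Y u) \<Longrightarrow> f X = f Y"
  by (auto simp: depends_on_def)

text \<open>
  A function that depends on the sites of \<open>K j\<close> is recovered from the restriction of the colouring to
  \<open>K j\<close>, filled up with an arbitrary colour elsewhere, and these restrictions are independent.
\<close>

lemma indep_vars_disjoint_dependence:
  fixes f :: "'i \<Rightarrow> ((int ^ 'n::finite) \<Rightarrow> nat) \<Rightarrow> real"
  assumes meas: "\<And>j. j \<in> L \<Longrightarrow> f j \<in> borel_measurable (color_law P)"
    and dep: "\<And>j. j \<in> L \<Longrightarrow> depends_on (K j) (f j)"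
    and disj: "disjoint_family_on K L"
  shows "color_law.indep_vars P (\<lambda>_. borel) f L"
proof -
  have "distr (color_law P) (measure_pmf P) (\<lambda>X. X u) = measure_pmf P" for u :: "int ^ 'n"
    using distr_PiM_component[of UNIV "\<lambda>_. measure_pmf P" u]
    by (simp add: measure_pmf.prob_space_axioms)
  then have "color_law.indep_vars P (\<lambda>_. measure_pmf P) (\<lambda>u X. X u) (UNIV :: (int ^ 'n) set)"
    by (subst color_law.indep_vars_iff_distr_eq_PiM)
       (simp_all add: distr_id2 restrict_def)
  from color_law.indep_vars_restrict[OF this _ disj]
  have "color_law.indep_vars P (\<lambda>j. PiM (K j) (\<lambda>_. measure_pmf P)) (\<lambda>j X. restrict X (K j)) L"
    by simp
  then have "color_law.indep_vars P (\<lambda>_. borel)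
      (\<lambda>j X. f j (\<lambda>u. if u \<in> K j then restrict X (K j) u else 0)) L"
  proof (rule color_law.indep_vars_compose2)
    fix j assume j: "j \<in> L"
    have "(\<lambda>Y u. if u \<in> K j then Y u else 0) \<in> measurable (PiM (K j) (\<lambda>_. measure_pmf P)) (color_law P)"
    proof (rule measurable_PiM_single')
      fix u :: "int ^ 'n"
      show "(\<lambda>Y. if u \<in> K j then Y u else 0) \<in> measurable (PiM (K j) (\<lambda>_. measure_pmf P)) (measure_pmf P)"
        using measurable_component_singleton[of u "K j" "\<lambda>_. measure_pmf P"]
        by (cases "u \<in> K j") auto
    qed auto
    from measurable_compose[OF this meas[OF j]]
    show "(\<lambda>Y. f j (\<lambda>u. if u \<in> K j then Y u else 0))
        \<in> borel_measurable (PiM (K j) (\<lambda>_. measure_pmf P))" .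
  qed
  moreover have "f j (\<lambda>u. if u \<in> K j then restrict X (K j) u else 0) = f j X" if "j \<in> L" for j X
    by (rule depends_onD[OF dep[OF that]]) auto
  ultimately show ?thesis
    by (subst color_law.indep_vars_cong[where I = L and J = L]) auto
qed

lemma prob_INT_disjoint_dependence:
  fixes A :: "'i \<Rightarrow> ((int ^ 'n::finite) \<Rightarrow> nat) set"
  assumes meas: "\<And>j. j \<in> L \<Longrightarrow> A j \<in> sets (color_law P)"
    and dep: "\<And>j. j \<in> L \<Longrightarrow> depends_on (K j) (\<lambda>X. X \<in> A j)"
    and disj: "disjoint_family_on K L" and "finite L" "L \<noteq> {}"
  shows "measure (color_law P) (\<Inter>j\<in>L. A j) = (\<Prod>j\<in>L. measure (color_law P) (A j))"
proof -
  define f where "f j X = (indicator (A j) X :: real)" for j X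
  have "color_law.indep_vars P (\<lambda>_. borel) f L"
  proof (rule indep_vars_disjoint_dependence[OF _ _ disj])
    show "f j \<in> borel_measurable (color_law P)" if "j \<in> L" for j
      using meas[OF that] unfolding f_def by measurable
    show "depends_on (K j) (f j)" if "j \<in> L" for j
      using dep[OF that] by (auto simp: depends_on_def f_def indicator_def)
  qed
  from color_law.indep_varsD[OF this \<open>L \<noteq> {}\<close> \<open>finite L\<close> subset_refl, of "\<lambda>_. {1}"]
  show ?thesis
    by (simp add: f_def vimage_def indicator_eq_1_iff)
qed

lemma color_law_cylinder:
  assumes "finite F"
  shows "measure (color_law P) {X. \<forall>u\<in>F. X u = a u} = (\<Prod>u\<in>F. pmf P (a u))"
proof -
  interpret product_prob_space "\<lambda>_. measure_pmf P" UNIV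
    by unfold_locales
  have "{X. \<forall>u\<in>F. X u = a u} = prod_emb UNIV (\<lambda>_. measure_pmf P) F (\<Pi>\<^sub>E u\<in>F. {a u})"
    by (auto simp: prod_emb_def PiE_iff)
  also have "measure (color_law P) \<dots> = (\<Prod>u\<in>F. measure (measure_pmf P) {a u})"
    using assms by (intro measure_PiM_emb) auto
  finally show ?thesis by (simp add: measure_pmf_single)
qed

text \<open>
  Restricting the integral to colourings with colours below \<open>k\<close> on \<open>F\<close> can only decrease it and
  turns it into a polynomial in finitely many of the \<open>q i\<close>, which is continuous for the pointwise
  topology.  Applied to \<open>C - f\<close>, the lemma gives the opposite semicontinuity.
\<close>

lemma expectation_lsc:
  fixes f :: "((int ^ 'n::finite) \<Rightarrow> nat) \<Rightarrow> real"
  assumes f [measurable]: "\<And>P. f \<in> borel_measurable (color_law P)"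
    and f_bounds: "\<And>X. 0 \<le> f X" "\<And>X. f X \<le> C"
    and "finite F" and dep: "depends_on F f"
    and p: "p \<in> color_simplex" and "\<eta> > 0"
  shows "\<forall>\<^sub>F q in at p within color_simplex.
           (\<integral>X. f X \<partial>coloring_law p) - \<eta> < (\<integral>X. f X \<partial>coloring_law q)"
proof -
  define g where "g k X = f X * indicator {X. \<forall>u\<in>F. X u < k} X" for k :: nat and X
  have g_meas [measurable]: "g k \<in> borel_measurable (color_law P)" for k P
  proof -
    have "{X. \<forall>u\<in>F. X u < k} = {X \<in> space (color_law P). \<forall>u\<in>F. X u < k}"
      by simp
    also have "\<dots> \<in> sets (color_law P)"
      using \<open>finite F\<close> by measurable
    finally show ?thesis unfolding g_def by measurable
  qed
  have g_le: "0 \<le> g k X" "g k X \<le> f X" "\<bar>g k X\<bar> \<le> C" for k X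
    using f_bounds[of X] by (auto simp: g_def indicator_def)
  have g_lim: "(\<lambda>k. g k X) \<longlonglongrightarrow> f X" for X
  proof (rule tendsto_eventually)
    have "\<forall>\<^sub>F k in sequentially. \<forall>u\<in>F. X u < k"
      using \<open>finite F\<close> by (simp add: eventually_ball_finite_distrib eventually_gt_at_top)
    then show "\<forall>\<^sub>F k in sequentially. g k X = f X"
      by eventually_elim (simp add: g_def)
  qed
  have "(\<lambda>k. \<integral>X. g k X \<partial>coloring_law p) \<longlonglongrightarrow> (\<integral>X. f X \<partial>coloring_law p)"
    unfolding coloring_law_def
    by (rule integral_dominated_convergence[where w="\<lambda>_. C"]) (use g_lim g_le in auto)
  then have "\<forall>\<^sub>F k in sequentially. (\<integral>X. f X \<partial>coloring_law p) - \<eta> < (\<integral>X. g k X \<partial>coloring_law p)"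
    using \<open>\<eta> > 0\<close> by (intro order_tendstoD(1)) auto
  then obtain k where k: "(\<integral>X. f X \<partial>coloring_law p) - \<eta> < (\<integral>X. g k X \<partial>coloring_law p)"
    by (auto simp: eventually_sequentially)
  define A where "A = (F \<rightarrow>\<^sub>E {..<k})"
  have "finite A"
    unfolding A_def using \<open>finite F\<close> by (intro finite_PiE) auto
  have g_sum: "g k X = (\<Sum>a\<in>A. f a * indicator {X. \<forall>u\<in>F. X u = a u} X)" for X
  proof -
    let ?a = "restrict X F"
    have *: "(\<forall>u\<in>F. X u = a u) \<longleftrightarrow> a = ?a" if "a \<in> A" for a
    proof
      assume "\<forall>u\<in>F. X u = a u"
      then show "a = ?a"
        using that by (intro ext) (auto simp: A_def PiE_def extensional_def restrict_def)
    qed auto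
    have "(\<Sum>a\<in>A. f a * indicator {X. \<forall>u\<in>F. X u = a u} X) = (\<Sum>a\<in>A. if a = ?a then f a else 0)"
      by (intro sum.cong) (auto simp: * indicator_def)
    also have "\<dots> = (if ?a \<in> A then f ?a else 0)"
      using \<open>finite A\<close> by (simp add: sum.delta)
    also have "?a \<in> A \<longleftrightarrow> (\<forall>u\<in>F. X u < k)"
      by (auto simp: A_def PiE_iff)
    also have "f ?a = f X"
      by (rule depends_onD[OF dep]) auto
    finally show ?thesis by (simp add: g_def indicator_def)
  qed
  have g_int: "(\<integral>X. g k X \<partial>coloring_law q) = (\<Sum>a\<in>A. f a * (\<Prod>u\<in>F. q (a u)))"
    if "q \<in> color_simplex" for q
  proof -
    have [measurable]: "{X. \<forall>u\<in>F. X u = a u} \<in> sets (color_law P)" for a P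
    proof -
      have "{X. \<forall>u\<in>F. X u = a u} = {X \<in> space (color_law P). \<forall>u\<in>F. X u = a u}"
        by simp
      also have "\<dots> \<in> sets (color_law P)"
        using \<open>finite F\<close> by measurable
      finally show ?thesis .
    qed
    have "integrable (coloring_law q) (\<lambda>X. f a * indicator {X. \<forall>u\<in>F. X u = a u} X)" for a
      unfolding coloring_law_def by (intro integrable_bounded[where C="\<bar>f a\<bar>"]) (auto simp: indicator_def)
    then have "(\<integral>X. g k X \<partial>coloring_law q)
        = (\<Sum>a\<in>A. f a * measure (coloring_law q) {X. \<forall>u\<in>F. X u = a u})"
      unfolding coloring_law_def g_sum
      by (subst Bochner_Integration.integral_sum) simp_all
    then show ?thesis
      unfolding coloring_law_def
      by (simp add: color_law_cylinder[OF \<open>finite F\<close>] pmf_embed_color_simplex[OF that])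
  qed
  have coord: "((\<lambda>q. q i) \<longlongrightarrow> p i) (at p within color_simplex)" for i :: nat
    using continuous_on_product_coordinates[of i]
    by (auto simp: continuous_on_def intro: tendsto_within_subset)
  have "((\<lambda>q. \<Sum>a\<in>A. f a * (\<Prod>u\<in>F. q (a u))) \<longlongrightarrow> (\<Sum>a\<in>A. f a * (\<Prod>u\<in>F. p (a u))))
      (at p within color_simplex)"
    by (intro tendsto_intros coord)
  then have "\<forall>\<^sub>F q in at p within color_simplex.
      (\<integral>X. f X \<partial>coloring_law p) - \<eta> < (\<Sum>a\<in>A. f a * (\<Prod>u\<in>F. q (a u)))"
    using k unfolding g_int[OF p] by (rule order_tendstoD(1))
  moreover have "\<forall>\<^sub>F q in at p within color_simplex. q \<in> color_simplex"
    by (simp add: eventually_at_filter)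
  ultimately show ?thesis
  proof eventually_elim
    case (elim q)
    have "(\<integral>X. g k X \<partial>coloring_law q) \<le> (\<integral>X. f X \<partial>coloring_law q)"
      unfolding coloring_law_def using g_le f_bounds
      by (intro integral_mono integrable_bounded[where C=C]) (auto simp: abs_le_iff intro: order_trans[of _ 0])
    with elim g_int show ?case by simp
  qed
qed

section \<open>The limit of the expected passage times\<close>

definition mean_time :: "nat pmf \<Rightarrow> int ^ 'n::finite \<Rightarrow> real" where
  "mean_time P u = (\<integral>X. real (passage_time X 0 u) \<partial>color_law P)"

lemma mean_time_nonneg [simp]: "0 \<le> mean_time P u"
  by (simp add: mean_time_def)

lemma mean_time_lipschitz: "mean_time P u \<le> mean_time P v + l1norm (site_vec u - site_vec v)"
proof -
  have "mean_time P u \<le> (\<integral>X. real (passage_time X 0 v) + l1norm (site_vec u - site_vec v) \<partial>color_law P)"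
    unfolding mean_time_def using passage_time_lipschitz[of _ 0 u 0 v]
    by (intro integral_mono) auto
  then show ?thesis
    by (simp add: mean_time_def)
qed

lemma mean_time_0 [simp]: "mean_time P 0 = 0"
  by (simp add: mean_time_def)

text \<open>
  A path to \<open>u + v\<close> may pass through \<open>u\<close>, and the second half has the law of a path from \<open>0\<close> to \<open>v\<close>
  because the law of the colouring is invariant under translations.
\<close>

lemma mean_time_subadditive: "mean_time P (u + v) \<le> mean_time P u + mean_time P v"
proof -
  have "mean_time P (u + v)
      \<le> (\<integral>X. real (passage_time X 0 u) + real (passage_time (shift u X) 0 v) \<partial>color_law P)"
    unfolding mean_time_def
  proof (rule integral_mono)
    show "real (passage_time X 0 (u + v))
        \<le> real (passage_time X 0 u) + real (passage_time (shift u X) 0 v)" for X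
      using passage_time_triangle[of X 0 "u + v" u]
      by (simp add: passage_time_shift add.commute flip: of_nat_add)
  qed (auto simp: passage_time_shift)
  also have "\<dots> = mean_time P u + mean_time P v"
    using integral_shift[of "\<lambda>X. real (passage_time X 0 v)" P u]
    by (subst Bochner_Integration.integral_add) (simp_all add: mean_time_def passage_time_shift)
  finally show ?thesis .
qed

definition floor_site :: "real ^ 'n::finite \<Rightarrow> int ^ 'n" where
  "floor_site x = (\<chi> i. \<lfloor>x $ i\<rfloor>)"

lemma floor_site_error:
  "l1norm (site_vec (floor_site x) - x) \<le> real CARD('n)" for x :: "real ^ 'n::finite"
  using l1norm_le[of "site_vec (floor_site x) - x" 1]
  by (simp add: site_vec_def floor_site_def abs_le_iff) linarith

lemma floor_site_site_vec [simp]: "floor_site (site_vec u) = u"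
  by (simp add: floor_site_def site_vec_def vec_eq_iff)

text \<open>
  Rounding spoils the subadditivity of the mean passage time by at most \<open>CARD('n)\<close>; adding
  this constant restores it.
\<close>

definition padded_mean :: "nat pmf \<Rightarrow> real ^ 'n::finite \<Rightarrow> real" where
  "padded_mean P x = mean_time P (floor_site x) + real CARD('n)"

lemma padded_mean_nonneg [simp]: "0 \<le> padded_mean P x"
  by (simp add: padded_mean_def)

lemma padded_mean_subadditive: "padded_mean P (x + y) \<le> padded_mean P x + padded_mean P y"
  for x y :: "real ^ 'n::finite"
proof -
  let ?u = "floor_site (x + y)" and ?v = "floor_site x + floor_site y"
  have "l1norm (site_vec ?u - site_vec ?v) \<le> real CARD('n) * 1"
  proof (rule l1norm_le)
    fix i
    have "\<lfloor>x $ i\<rfloor> + \<lfloor>y $ i\<rfloor> \<le> \<lfloor>x $ i + y $ i\<rfloor>" "\<lfloor>x $ i + y $ i\<rfloor> \<le> \<lfloor>x $ i\<rfloor> + \<lfloor>y $ i\<rfloor> + 1"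
      by linarith+
    then show "\<bar>(site_vec ?u - site_vec ?v) $ i\<bar> \<le> 1"
      by (simp add: site_vec_def floor_site_def)
  qed
  then show ?thesis
    using mean_time_lipschitz[of P ?u ?v] mean_time_subadditive[of P "floor_site x" "floor_site y"]
    by (simp add: padded_mean_def)
qed

text \<open>
  Fekete's subadditive lemma: write \<open>n\<close> as a multiple of a nearly optimal \<open>N\<close> plus a remainder.
\<close>

lemma Fekete:
  fixes a :: "nat \<Rightarrow> real"
  assumes nonneg: "\<And>n. 0 \<le> a n" and subadd: "\<And>m n. a (m + n) \<le> a m + a n"
  shows "(\<lambda>n. a n / real n) \<longlonglongrightarrow> (INF n\<in>{1..}. a n / real n)"
proof (rule order_tendstoI)
  let ?L = "INF n\<in>{1..}. a n / real n"
  have bdd: "bdd_below ((\<lambda>n. a n / real n) ` {1..})"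
    using nonneg by (intro bdd_belowI2[of _ 0]) simp
  have lower: "?L \<le> a n / real n" if "n \<ge> 1" for n
    using that by (intro cINF_lower bdd) simp
  show "\<forall>\<^sub>F n in sequentially. l < a n / real n" if "l < ?L" for l
    using eventually_ge_at_top[of 1] by eventually_elim (use lower that in \<open>auto intro: less_le_trans\<close>)
  fix l assume "?L < l"
  then obtain N where N: "N \<ge> 1" "a N / real N < l"
    using cINF_less_iff[OF _ bdd, of l] by auto
  have mult: "a (m * k) \<le> real m * a k + a 0" for m k
  proof (induction m)
    case (Suc m)
    have "a (Suc m * k) \<le> a k + a (m * k)" using subadd[of k "m * k"] by simp
    with Suc show ?case by (simp add: algebra_simps)
  qed simp
  define c where "c = real N * a 1 + 2 * a 0"
  have bound: "a n / real n \<le> a N / real N + c / real n" if "n \<ge> 1" for n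
  proof -
    have "a n \<le> a (n div N * N) + a (n mod N * 1)"
      using subadd[of "n div N * N" "n mod N"] by simp
    also have "\<dots> \<le> (real (n div N) * a N + a 0) + (real (n mod N) * a 1 + a 0)"
      by (intro add_mono mult)
    also have "real (n mod N) * a 1 \<le> real N * a 1"
      using N nonneg by (intro mult_right_mono) auto
    also have "real (n div N) * a N \<le> real n / real N * a N"
      using nonneg by (intro mult_right_mono of_nat_div_le_of_nat) auto
    finally have "a n \<le> real n * (a N / real N) + c"
      by (simp add: c_def algebra_simps)
    then show ?thesis
      using that by (simp add: field_simps)
  qed
  have "(\<lambda>n. a N / real N + c / real n) \<longlonglongrightarrow> a N / real N + 0"
    by (intro tendsto_intros lim_const_over_n)
  then have "\<forall>\<^sub>F n in sequentially. a N / real N + c / real n < l"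
    using N(2) by (intro order_tendstoD(2)) auto
  then show "\<forall>\<^sub>F n in sequentially. a n / real n < l"
    using eventually_ge_at_top[of 1] by eventually_elim (use bound in \<open>auto intro: le_less_trans\<close>)
qed

definition rate :: "nat pmf \<Rightarrow> real ^ 'n::finite \<Rightarrow> real" where
  "rate P x = (INF n\<in>{1..}. padded_mean P (real n *\<^sub>R x) / real n)"

lemma rate_limit: "(\<lambda>n. padded_mean P (real n *\<^sub>R x) / real n) \<longlonglongrightarrow> rate P x"
  unfolding rate_def
  using Fekete[of "\<lambda>n. padded_mean P (real n *\<^sub>R x)"] padded_mean_subadditive[of P "real _ *\<^sub>R x"]
  by (simp add: scaleR_add_left)

lemma rate_le: "n \<ge> 1 \<Longrightarrow> rate P x \<le> padded_mean P (real n *\<^sub>R x) / real n"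
  unfolding rate_def by (rule cINF_lower) (auto intro!: bdd_belowI2[of _ 0])

lemma rate_nonneg [simp]: "0 \<le> rate P x"
  unfolding rate_def by (rule cINF_greatest) auto

lemma rate_triangle: "rate P (x + y) \<le> rate P x + rate P y"
proof (rule LIMSEQ_le[OF rate_limit tendsto_add[OF rate_limit rate_limit]])
  show "\<exists>N. \<forall>n\<ge>N. padded_mean P (real n *\<^sub>R (x + y)) / real n
      \<le> padded_mean P (real n *\<^sub>R x) / real n + padded_mean P (real n *\<^sub>R y) / real n"
    using padded_mean_subadditive[of P "real _ *\<^sub>R x" "real _ *\<^sub>R y"]
    by (auto simp: scaleR_add_right add_divide_distrib [symmetric] intro!: divide_right_mono)
qed

lemma rate_le_l1norm: "rate P x \<le> l1norm x" for x :: "real ^ 'n::finite"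
proof (rule LIMSEQ_le)
  show "(\<lambda>n. padded_mean P (real n *\<^sub>R x) / real n) \<longlonglongrightarrow> rate P x" by (rule rate_limit)
  have "(\<lambda>n. l1norm x + 2 * real CARD('n) / real n) \<longlonglongrightarrow> l1norm x + 0"
    by (intro tendsto_intros lim_const_over_n)
  then show "(\<lambda>n. l1norm x + 2 * real CARD('n) / real n) \<longlonglongrightarrow> l1norm x" by simp
  have "padded_mean P (real n *\<^sub>R x) / real n \<le> l1norm x + 2 * real CARD('n) / real n" if "n \<ge> 1" for n
  proof -
    let ?y = "real n *\<^sub>R x"
    have "mean_time P (floor_site ?y) \<le> l1norm (site_vec (floor_site ?y))"
      using mean_time_lipschitz[of P "floor_site ?y" 0] by simp
    also have "\<dots> \<le> l1norm (site_vec (floor_site ?y) - ?y) + l1norm ?y"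
      using l1norm_triangle[of "site_vec (floor_site ?y) - ?y" ?y] by simp
    also have "\<dots> \<le> real CARD('n) + real n * l1norm x"
      using floor_site_error[of ?y] by (simp add: l1norm_scale)
    finally have "padded_mean P ?y / real n \<le> (real n * l1norm x + 2 * real CARD('n)) / real n"
      by (intro divide_right_mono) (simp_all add: padded_mean_def)
    then show ?thesis
      using that by (simp add: add_divide_distrib)
  qed
  then show "\<exists>N. \<forall>n\<ge>N. padded_mean P (real n *\<^sub>R x) / real n \<le> l1norm x + 2 * real CARD('n) / real n"
    by blast
qed

lemma rate_lipschitz: "rate P x \<le> rate P y + l1norm (x - y)"
  using rate_triangle[of P y "x - y"] rate_le_l1norm[of P "x - y"] by simp

lemma rate_scale_nat: "rate P (real k *\<^sub>R x) = real k * rate P x"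
proof (cases "k = 0")
  case True
  then show ?thesis
    using rate_le_l1norm[of P "0 *\<^sub>R x"] by (simp add: antisym)
next
  case False
  then have "(\<lambda>n. real k * (padded_mean P (real (n * k) *\<^sub>R x) / real (n * k))) \<longlonglongrightarrow> real k * rate P x"
    by (intro tendsto_mult_left filterlim_compose[OF rate_limit]
          filterlim_subseq) (auto simp: strict_mono_def)
  moreover have "real k * (padded_mean P (real (n * k) *\<^sub>R x) / real (n * k))
      = padded_mean P (real n *\<^sub>R (real k *\<^sub>R x)) / real n" for n
    using False by (simp add: field_simps)
  ultimately show ?thesis
    using LIMSEQ_unique[OF rate_limit[of P "real k *\<^sub>R x"]] by simp
qed

text \<open>
  For real \<open>t\<close> compare \<open>n t x\<close> with \<open>\<lfloor>n t\<rfloor> x\<close>: the rates differ by a bounded amount, which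
  disappears after division by \<open>n\<close>.
\<close>

lemma rate_scale:
  assumes "t \<ge> 0"
  shows "rate P (t *\<^sub>R x) = t * rate P x"
proof -
  have bound: "\<bar>rate P (t *\<^sub>R x) - t * rate P x\<bar> \<le> (l1norm x + rate P x) / real n" if "n \<ge> 1" for n
  proof -
    define k where "k = nat \<lfloor>real n * t\<rfloor>"
    have k: "real k \<le> real n * t" "real n * t < real k + 1"
      using assms by (simp_all add: k_def)
    have "l1norm ((real n * t) *\<^sub>R x - real k *\<^sub>R x) \<le> 1 * l1norm x"
      unfolding scaleR_diff_left [symmetric] l1norm_scale
      using k by (intro mult_right_mono) auto
    then have "\<bar>rate P ((real n * t) *\<^sub>R x) - rate P (real k *\<^sub>R x)\<bar> \<le> l1norm x"
      using rate_lipschitz[of P "(real n * t) *\<^sub>R x" "real k *\<^sub>R x"]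
        rate_lipschitz[of P "real k *\<^sub>R x" "(real n * t) *\<^sub>R x"]
      by (simp add: l1norm_minus_commute[of "real k *\<^sub>R x"])
    moreover have "\<bar>real k * rate P x - real n * t * rate P x\<bar> \<le> 1 * rate P x"
      unfolding left_diff_distrib [symmetric] abs_mult
      using k by (intro mult_mono) auto
    ultimately have "\<bar>real n * rate P (t *\<^sub>R x) - real n * (t * rate P x)\<bar> \<le> l1norm x + rate P x"
      using rate_scale_nat[of P n "t *\<^sub>R x"] rate_scale_nat[of P k x] by (simp add: mult.assoc)
    then have "real n * \<bar>rate P (t *\<^sub>R x) - t * rate P x\<bar> \<le> l1norm x + rate P x"
      by (simp add: right_diff_distrib [symmetric] abs_mult)
    then show ?thesis
      using that by (simp add: field_simps)
  qed
  have "\<bar>rate P (t *\<^sub>R x) - t * rate P x\<bar> \<le> 0"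
    by (rule LIMSEQ_le_const[OF lim_const_over_n[of "l1norm x + rate P x"]]) (use bound in auto)
  then show ?thesis by simp
qed

section \<open>The upper tail\<close>

definition best_time :: "('v \<Rightarrow> nat) \<Rightarrow> 'v list set \<Rightarrow> nat" where
  "best_time X \<Gamma> = Min (path_time X ` \<Gamma>)"

lemma depends_on_path_time: "depends_on (set \<gamma>) (\<lambda>X. path_time X \<gamma>)"
  unfolding depends_on_def path_time_def edge_time_def by (auto intro!: sum.cong)

lemma depends_on_best_time: "depends_on (\<Union>\<gamma>\<in>\<Gamma>. set \<gamma>) (\<lambda>X. best_time X \<Gamma>)"
  unfolding depends_on_def best_time_def
  by (auto intro!: arg_cong[where f=Min] image_cong depends_onD[OF depends_on_path_time])

lemma path_time_le_length: "path_time X \<gamma> \<le> length \<gamma>"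
proof -
  have "path_time X \<gamma> \<le> (\<Sum>k<length \<gamma> - 1. 1)"
    unfolding path_time_def by (intro sum_mono) (simp add: edge_time_def)
  then show ?thesis by simp
qed

lemma measurable_best_time [measurable]:
  assumes "finite \<Gamma>" "\<Gamma> \<noteq> {}"
  shows "(\<lambda>X. real (best_time X \<Gamma>)) \<in> borel_measurable (color_law P)"
proof -
  have "real (best_time X \<Gamma>) = Min ((\<lambda>\<gamma>. real (path_time X \<gamma>)) ` \<Gamma>)" for X
    unfolding best_time_def using assms
    by (subst mono_Min_commute) (auto simp: mono_def image_image)
  then show ?thesis
    using assms by (simp add: borel_measurable_Min)
qed

lemma passage_time_le_best_time:
  "finite \<Gamma> \<Longrightarrow> \<Gamma> \<noteq> {} \<Longrightarrow> \<Gamma> \<subseteq> paths u v \<Longrightarrow> passage_time X u v \<le> best_time X \<Gamma>"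
  by (auto simp: best_time_def intro!: passage_time_le)

lemma best_time_bounded:
  assumes "finite \<Gamma>" "\<Gamma> \<noteq> {}"
  obtains C where "\<And>X. best_time X \<Gamma> \<le> C" "C > 0"
proof -
  obtain \<gamma> where "\<gamma> \<in> \<Gamma>" using assms by auto
  then have "best_time X \<Gamma> \<le> path_time X \<gamma>" for X
    unfolding best_time_def using assms by (intro Min_le) auto
  then have "best_time X \<Gamma> \<le> Suc (length \<gamma>)" for X
    using path_time_le_length[of X \<gamma>] by (meson le_SucI le_trans)
  then show thesis using that by blast
qed

lemma integrable_best_time:
  assumes "finite \<Gamma>" "\<Gamma> \<noteq> {}"
  shows "integrable (color_law P) (\<lambda>X. real (best_time X \<Gamma>))"
proof -
  obtain C where "\<And>X. best_time X \<Gamma> \<le> C" using best_time_bounded[OF assms] by blast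
  then show ?thesis
    using assms by (intro integrable_bounded[where C="real C"]) auto
qed

text \<open>
  The passage time involves infinitely many paths, hence infinitely many sites.  Finitely many
  of these paths already give almost the same expectation, at the price of an upper bound.
\<close>

lemma finitely_many_paths_suffice:
  assumes "\<eta> > 0"
  obtains \<Gamma> where "finite \<Gamma>" "\<Gamma> \<noteq> {}" "\<Gamma> \<subseteq> paths 0 v"
    "(\<integral>X. real (best_time X \<Gamma>) \<partial>color_law P) < mean_time P v + \<eta>"
proof -
  let ?e = "from_nat_into (paths 0 v)"
  have ne: "paths 0 v \<noteq> {}"
    using ex_path_le_l1[of 0 v "\<lambda>_. 0"] by auto
  define \<Gamma> where "\<Gamma> k = ?e ` {..k}" for k :: nat
  have \<Gamma>: "finite (\<Gamma> k)" "\<Gamma> k \<noteq> {}" "\<Gamma> k \<subseteq> paths 0 v" for k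
    using from_nat_into[OF ne] by (auto simp: \<Gamma>_def)
  have bound: "best_time X (\<Gamma> k) \<le> length (?e 0)" for X k
  proof -
    have "best_time X (\<Gamma> k) \<le> path_time X (?e 0)"
      unfolding best_time_def using \<Gamma> by (intro Min_le) (auto simp: \<Gamma>_def)
    then show ?thesis using path_time_le_length[of X "?e 0"] by linarith
  qed
  have lim: "(\<lambda>k. real (best_time X (\<Gamma> k))) \<longlonglongrightarrow> real (passage_time X 0 v)" for X
  proof (rule tendsto_eventually)
    obtain \<gamma> where \<gamma>: "\<gamma> \<in> paths 0 v" "path_time X \<gamma> = passage_time X 0 v"
      by (rule geodesic_exists)
    obtain m where m: "?e m = \<gamma>"
      using from_nat_into_surj[OF _ \<gamma>(1)] by auto
    show "\<forall>\<^sub>F k in sequentially. real (best_time X (\<Gamma> k)) = real (passage_time X 0 v)"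
      using eventually_ge_at_top[of m]
    proof eventually_elim
      case (elim k)
      have "best_time X (\<Gamma> k) \<le> path_time X \<gamma>"
        unfolding best_time_def using \<Gamma> elim m by (intro Min_le) (auto simp: \<Gamma>_def)
      moreover have "passage_time X 0 v \<le> best_time X (\<Gamma> k)"
        using \<Gamma> by (rule passage_time_le_best_time)
      ultimately show ?case using \<gamma> by simp
    qed
  qed
  have "(\<lambda>k. \<integral>X. real (best_time X (\<Gamma> k)) \<partial>color_law P) \<longlonglongrightarrow> mean_time P v"
    unfolding mean_time_def
    by (rule integral_dominated_convergence[where w="\<lambda>_. real (length (?e 0))"])
       (use lim bound \<Gamma> in auto)
  then have "\<forall>\<^sub>F k in sequentially. (\<integral>X. real (best_time X (\<Gamma> k)) \<partial>color_law P) < mean_time P v + \<eta>"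
    using assms by (intro order_tendstoD(2)) auto
  then obtain k where "(\<integral>X. real (best_time X (\<Gamma> k)) \<partial>color_law P) < mean_time P v + \<eta>"
    by (auto simp: eventually_sequentially)
  with \<Gamma> show thesis by (rule that)
qed

lemma multiple_simps [simp]: "int 0 *s v = 0" "site_vec (int n *s v) = real n *\<^sub>R site_vec v"
  using site_vec_simps(5)[of "int n" v] by (simp_all add: vec_eq_iff site_vec_def)

lemma multiple_Suc: "int (Suc n) *s v = v + int n *s v"
  by (simp add: vec_eq_iff algebra_simps)

lemma passage_time_le_sum_best_time:
  assumes "finite \<Gamma>" "\<Gamma> \<noteq> {}" "\<Gamma> \<subseteq> paths 0 v"
  shows "passage_time X 0 (int n *s v) \<le> (\<Sum>i<n. best_time (shift (int i *s v) X) \<Gamma>)"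
proof (induction n)
  case (Suc n)
  have "passage_time X (int n *s v) (int (Suc n) *s v) \<le> best_time (shift (int n *s v) X) \<Gamma>"
    using passage_time_le_best_time[OF assms, of "shift (int n *s v) X"]
    by (simp only: passage_time_shift multiple_Suc add_0_left)
  then show ?case
    using Suc passage_time_triangle[of X 0 "int (Suc n) *s v" "int n *s v"] by simp
qed simp

text \<open>
  If some coordinate of \<open>v\<close> is nonzero and bounded by \<open>R\<close> on \<open>U\<close>, then translates of \<open>U\<close> by different
  multiples of \<open>K v\<close> with \<open>K > 2 R\<close> cannot meet.
\<close>

lemma translates_disjoint:
  fixes v :: "int ^ 'n::finite"
  assumes "finite U" "v \<noteq> 0"
  obtains K where "K > 0"
    "\<And>r. disjoint_family_on (\<lambda>j. (\<lambda>u. u + int (r + j * K) *s v) ` U) UNIV"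
proof -
  obtain c where c: "v $ c \<noteq> 0" using \<open>v \<noteq> 0\<close> by (auto simp: vec_eq_iff)
  define R where "R = Max ((\<lambda>u. \<bar>u $ c\<bar>) ` U)"
  have R: "\<bar>u $ c\<bar> \<le> R" if "u \<in> U" for u
    unfolding R_def using that \<open>finite U\<close> by (intro Max_ge) auto
  define K where "K = nat (2 * \<bar>R\<bar> + 1)"
  show thesis
  proof (rule that)
    show "K > 0" by (simp add: K_def)
    fix r
    have False if "i \<noteq> j" "u \<in> U" "u' \<in> U"
      and eq: "u + int (r + i * K) *s v = u' + int (r + j * K) *s v" for i j u u'
    proof -
      have "u $ c - u' $ c = (int j - int i) * int K * v $ c"
        using arg_cong[OF eq, of "\<lambda>w. w $ c"] by (simp add: algebra_simps)
      then have "\<bar>u $ c - u' $ c\<bar> = \<bar>int j - int i\<bar> * (int K * \<bar>v $ c\<bar>)"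
        by (simp add: abs_mult mult.assoc)
      also have "\<dots> \<ge> 1 * (int K * 1)"
        using \<open>i \<noteq> j\<close> c by (intro mult_mono) auto
      finally show False
        using R[OF \<open>u \<in> U\<close>] R[OF \<open>u' \<in> U\<close>] by (simp add: K_def)
    qed
    then show "disjoint_family_on (\<lambda>j. (\<lambda>u. u + int (r + j * K) *s v) ` U) UNIV"
      unfolding disjoint_family_on_def by blast
  qed
qed

text \<open>
  Hoeffding's inequality gives exponentially small probabilities, so the Borel-Cantelli lemma applies.
\<close>

lemma Hoeffding_eventually:
  fixes Z :: "nat \<Rightarrow> ((int ^ 'n::finite) \<Rightarrow> nat) \<Rightarrow> real"
  assumes indep: "color_law.indep_vars P (\<lambda>_. borel) Z UNIV"
    and bounds: "\<And>j X. Z j X \<in> {0..C}" and "C > 0"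
    and mean: "\<And>j. (\<integral>X. Z j X \<partial>color_law P) = m" and "\<eta> > 0"
  shows "AE X in color_law P. \<forall>\<^sub>F J in sequentially. (\<Sum>j<J. Z j X) < real J * (m + \<eta>)"
proof -
  have meas [measurable]: "Z j \<in> borel_measurable (color_law P)" for j
    using indep by (auto simp: color_law.indep_vars_def)
  define A where "A J = {X \<in> space (color_law P). real J * m + real J * \<eta> \<le> (\<Sum>j<J. Z j X)}" for J
  have A_meas [measurable]: "A J \<in> sets (color_law P)" for J
    unfolding A_def by measurable
  define \<rho> where "\<rho> = exp (- (2 * \<eta>\<^sup>2 / C\<^sup>2))"
  have prob_A: "measure (color_law P) (A J) \<le> \<rho> ^ J" if "J \<ge> 1" for J
  proof -
    interpret H: Hoeffding_ineq "color_law P" "{..<J}" Z "\<lambda>_. 0" "\<lambda>_. C"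
      "\<Sum>j<J. \<integral>X. Z j X \<partial>color_law P"
    proof unfold_locales
      show "color_law.indep_vars P (\<lambda>_. borel) Z {..<J}"
        using indep by (rule color_law.indep_vars_subset) auto
    qed (use bounds in auto)
    have "measure (color_law P) (A J) \<le> exp (- 2 * (real J * \<eta>)\<^sup>2 / (\<Sum>j<J. (C - 0)\<^sup>2))"
      using H.Hoeffding_ineq_ge[of "real J * \<eta>"] that \<open>C > 0\<close> \<open>\<eta> > 0\<close>
      by (simp add: A_def mean)
    also have "- 2 * (real J * \<eta>)\<^sup>2 / (\<Sum>j<J. (C - 0)\<^sup>2) = real J * - (2 * \<eta>\<^sup>2 / C\<^sup>2)"
      using that \<open>C > 0\<close> by (simp add: field_simps power2_eq_square)
    also have "exp \<dots> = \<rho> ^ J"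
      unfolding \<rho>_def by (rule exp_of_nat_mult)
    finally show ?thesis .
  qed
  have "summable (\<lambda>J. measure (color_law P) (A J))"
  proof (rule summable_comparison_test')
    show "summable (\<lambda>J. \<rho> ^ J)"
      using \<open>C > 0\<close> \<open>\<eta> > 0\<close> by (simp add: \<rho>_def)
    show "norm (measure (color_law P) (A J)) \<le> \<rho> ^ J" if "J \<ge> 1" for J
      using prob_A[OF that] by simp
  qed
  then have "AE X in color_law P. \<forall>\<^sub>F J in sequentially. X \<in> space (color_law P) - A J"
    by (intro borel_cantelli_AE1) (simp_all add: color_law.emeasure_eq_measure)
  then show ?thesis
    by eventually_elim (simp add: A_def not_le distrib_left)
qed

text \<open>
  Along the multiples of \<open>v\<close> the local passage times \<open>best_time\<close> of consecutive steps form a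
  stationary sequence, split here into \<open>K\<close> interlaced independent ones.
\<close>

lemma upper_bound_along_multiples:
  fixes v :: "int ^ 'n::finite"
  assumes "\<eta> > 0"
  obtains K where "K > 0"
    "AE X in color_law P. \<forall>\<^sub>F J in sequentially.
       real (passage_time X 0 (int (J * K) *s v)) \<le> real (J * K) * (mean_time P v + \<eta>)"
proof (cases "v = 0")
  case True
  then show thesis
    using that[of 1] assms by simp
next
  case False
  obtain \<Gamma> where \<Gamma>: "finite \<Gamma>" "\<Gamma> \<noteq> {}" "\<Gamma> \<subseteq> paths 0 v"
    "(\<integral>X. real (best_time X \<Gamma>) \<partial>color_law P) < mean_time P v + \<eta>"
    using finitely_many_paths_suffice[OF assms] by blast
  obtain C where C: "\<And>X. best_time X \<Gamma> \<le> C" "C > 0"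
    using best_time_bounded[OF \<Gamma>(1,2)] by blast
  define m where "m = (\<integral>X. real (best_time X \<Gamma>) \<partial>color_law P)"
  define U where "U = (\<Union>\<gamma>\<in>\<Gamma>. set \<gamma>)"
  have "finite U" using \<Gamma>(1) by (simp add: U_def)
  then obtain K where K: "K > 0"
    "\<And>r. disjoint_family_on (\<lambda>j. (\<lambda>u. u + int (r + j * K) *s v) ` U) UNIV"
    using translates_disjoint[OF _ False] by metis
  define Y where "Y i X = real (best_time (shift (int i *s v) X) \<Gamma>)" for i X
  have best_meas [measurable]: "(\<lambda>X. real (best_time X \<Gamma>)) \<in> borel_measurable (color_law P)"
    using \<Gamma>(1,2) by (rule measurable_best_time)
  have Y_meas: "Y i \<in> borel_measurable (color_law P)" for i
    unfolding Y_def by measurable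
  have Y_mean: "(\<integral>X. Y i X \<partial>color_law P) = m" for i
    unfolding Y_def m_def using best_meas by (rule integral_shift)
  have Y_dep: "depends_on ((\<lambda>u. u + int i *s v) ` U) (Y i)" for i
    using depends_on_best_time[of \<Gamma>] unfolding depends_on_def Y_def U_def [symmetric] shift_def by auto
  have "AE X in color_law P. \<forall>\<^sub>F J in sequentially.
      (\<Sum>j<J. Y (r + j * K) X) < real J * (m + (mean_time P v + \<eta> - m))" for r
  proof (rule Hoeffding_eventually)
    show "color_law.indep_vars P (\<lambda>_. borel) (\<lambda>j. Y (r + j * K)) UNIV"
      by (rule indep_vars_disjoint_dependence[OF Y_meas Y_dep K(2)])
    show "Y (r + j * K) X \<in> {0..real C}" for j X
      using C by (simp add: Y_def)
  qed (use C \<Gamma>(4) Y_mean in \<open>auto simp: m_def\<close>)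
  then have "AE X in color_law P. \<forall>r\<in>{..<K}. \<forall>\<^sub>F J in sequentially.
      (\<Sum>j<J. Y (r + j * K) X) < real J * (mean_time P v + \<eta>)"
    by (intro AE_finite_allI) auto
  then have "AE X in color_law P. \<forall>\<^sub>F J in sequentially.
       real (passage_time X 0 (int (J * K) *s v)) \<le> real (J * K) * (mean_time P v + \<eta>)"
  proof eventually_elim
    case (elim X)
    then have "\<forall>\<^sub>F J in sequentially. \<forall>r\<in>{..<K}.
        (\<Sum>j<J. Y (r + j * K) X) < real J * (mean_time P v + \<eta>)"
      by (simp add: eventually_ball_finite_distrib)
    then show ?case
    proof eventually_elim
      case (elim J)
      have "real (passage_time X 0 (int (J * K) *s v)) \<le> (\<Sum>i<J * K. Y i X)"
        unfolding Y_def of_nat_sum [symmetric] of_nat_le_iff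
        by (rule passage_time_le_sum_best_time[OF \<Gamma>(1-3)])
      also have "\<dots> = (\<Sum>j<J. \<Sum>i\<in>{j * K..<j * K + K}. Y i X)"
        by (rule sum.nat_group [symmetric])
      also have "\<dots> = (\<Sum>j<J. \<Sum>r<K. Y (r + j * K) X)"
        using sum.shift_bounds_nat_ivl[of "\<lambda>i. Y i X" 0 "_ * K" K]
        by (simp add: add.commute lessThan_atLeast0)
      also have "\<dots> = (\<Sum>r<K. \<Sum>j<J. Y (r + j * K) X)"
        by (rule sum.swap)
      also have "\<dots> \<le> (\<Sum>r<K. real J * (mean_time P v + \<eta>))"
        using elim by (intro sum_mono) (auto intro: less_imp_le)
      also have "\<dots> = real (J * K) * (mean_time P v + \<eta>)"
        by simp
      finally show ?case .
    qed
  qed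
  with K(1) show thesis by (rule that)
qed

lemma passage_time_floor_site_le:
  "real (passage_time X 0 (floor_site y)) \<le> l1norm y + real CARD('n)" for y :: "real ^ 'n::finite"
proof -
  have "real (passage_time X 0 (floor_site y)) \<le> l1norm (site_vec (floor_site y))"
    using passage_time_le_l1[of X 0 "floor_site y"] by (simp add: l1norm_def)
  then show ?thesis
    using l1norm_triangle[of "site_vec (floor_site y) - y" y] floor_site_error[of y] by simp
qed

text \<open>
  Go to \<open>n x\<close> along multiples of \<open>K v\<close>, where \<open>v\<close> is the site below \<open>N x\<close>.  The rounding error of each
  of the \<open>J K\<close> steps is the term that \<open>padded_mean\<close> adds to the mean, and the last incomplete stretch costs a
  bounded amount \<open>c\<close>.
\<close>

lemma upper_tail_fixed:
  fixes x :: "real ^ 'n::finite"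
  assumes "\<eta> > 0"
  shows "AE X in color_law P. \<forall>\<^sub>F n in sequentially.
    real (passage_time X 0 (floor_site (real n *\<^sub>R x))) \<le> real n * (rate P x + \<eta>)"
proof -
  let ?d = "real CARD('n)"
  have "(\<lambda>n. padded_mean P (real n *\<^sub>R x) / real n + 1 / real n) \<longlonglongrightarrow> rate P x + 0"
    by (intro tendsto_add rate_limit lim_const_over_n)
  then have "\<forall>\<^sub>F n in sequentially. padded_mean P (real n *\<^sub>R x) / real n + 1 / real n < rate P x + \<eta> / 2"
    using assms by (intro order_tendstoD(2)) auto
  then have "\<forall>\<^sub>F n in sequentially. padded_mean P (real n *\<^sub>R x) / real n + 1 / real n < rate P x + \<eta> / 2 \<and> n \<ge> 1"
    by (intro eventually_conj eventually_ge_at_top)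
  then obtain N where "padded_mean P (real N *\<^sub>R x) / real N + 1 / real N < rate P x + \<eta> / 2" and N: "N \<ge> 1"
    by (auto simp: eventually_sequentially)
  then have rateN: "padded_mean P (real N *\<^sub>R x) + 1 \<le> real N * (rate P x + \<eta> / 2)"
    by (simp add: field_simps)
  define v where "v = floor_site (real N *\<^sub>R x)"
  obtain K where K: "K > 0"
    "AE X in color_law P. \<forall>\<^sub>F J in sequentially.
       real (passage_time X 0 (int (J * K) *s v)) \<le> real (J * K) * (mean_time P v + 1)"
    using upper_bound_along_multiples[of 1] by auto
  define c where "c = ?d + real (K * N) * l1norm x"
  have "(\<lambda>n. c / real n) \<longlonglongrightarrow> 0" by (rule lim_const_over_n)
  then have "\<forall>\<^sub>F n in sequentially. c / real n < \<eta> / 2"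
    using assms by (intro order_tendstoD(2)) auto
  then have c_small: "\<forall>\<^sub>F n in sequentially. c \<le> real n * (\<eta> / 2)"
    using eventually_gt_at_top[of 0] by eventually_elim (simp add: field_simps)
  from K(2) show ?thesis
  proof eventually_elim
    case (elim X)
    then obtain J0 where J0: "\<And>J. J \<ge> J0 \<Longrightarrow>
        real (passage_time X 0 (int (J * K) *s v)) \<le> real (J * K) * (mean_time P v + 1)"
      by (auto simp: eventually_sequentially)
    show ?case
      using c_small eventually_ge_at_top[of "J0 * (K * N)"]
    proof eventually_elim
      case (elim n)
      define J where "J = n div (K * N)"
      have "J \<ge> J0"
        unfolding J_def using K(1) N elim by (simp add: less_eq_div_iff_mult_less_eq)
      have J_le: "real (J * K) * real N \<le> real n"
        unfolding J_def using div_times_less_eq_dividend[of n "K * N"]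
        by (simp flip: of_nat_mult add: mult.assoc)
      have J_ge: "real n - real (J * K) * real N \<le> real (K * N)"
      proof -
        have "n < J * (K * N) + K * N"
          unfolding J_def using dividend_less_div_times[of "K * N" n] K(1) N by (simp add: add.commute)
        then have "real n \<le> real (J * (K * N) + K * N)"
          by (simp only: of_nat_le_iff less_imp_le)
        then show ?thesis by (simp add: algebra_simps)
      qed
      have "l1norm (real n *\<^sub>R x - (real (J * K) * real N) *\<^sub>R x) \<le> real (K * N) * l1norm x"
        unfolding scaleR_diff_left [symmetric] l1norm_scale
        using J_le J_ge by (intro mult_right_mono) auto
      moreover have "l1norm ((real (J * K) * real N) *\<^sub>R x - real (J * K) *\<^sub>R site_vec v) \<le> real (J * K) * ?d"
      proof -
        have "(real (J * K) * real N) *\<^sub>R x - real (J * K) *\<^sub>R site_vec v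
            = real (J * K) *\<^sub>R (real N *\<^sub>R x - site_vec v)"
          by (simp add: scaleR_diff_right)
        moreover have "l1norm (real N *\<^sub>R x - site_vec v) \<le> ?d"
          using floor_site_error[of "real N *\<^sub>R x"] by (simp add: v_def l1norm_minus_commute)
        ultimately show ?thesis
          by (simp add: l1norm_scale mult_left_mono del: of_nat_mult)
      qed
      moreover have "l1norm (site_vec (floor_site (real n *\<^sub>R x)) - real n *\<^sub>R x) \<le> ?d"
        by (rule floor_site_error)
      ultimately have "l1norm (site_vec (floor_site (real n *\<^sub>R x)) - real (J * K) *\<^sub>R site_vec v)
          \<le> c + real (J * K) * ?d"
        unfolding c_def
        using l1norm_triangle_diff[of "site_vec (floor_site (real n *\<^sub>R x))" "real (J * K) *\<^sub>R site_vec v" "real n *\<^sub>R x"]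
          l1norm_triangle_diff[of "real n *\<^sub>R x" "real (J * K) *\<^sub>R site_vec v" "(real (J * K) * real N) *\<^sub>R x"]
        by linarith
      then have "real (passage_time X 0 (floor_site (real n *\<^sub>R x)))
          \<le> real (J * K) * (mean_time P v + 1) + (c + real (J * K) * ?d)"
        using passage_time_lipschitz[of X 0 "floor_site (real n *\<^sub>R x)" 0 "int (J * K) *s v"]
          J0[OF \<open>J \<ge> J0\<close>] by (simp del: of_nat_mult)
      also have "\<dots> = real (J * K) * (padded_mean P (real N *\<^sub>R x) + 1) + c"
        by (simp add: padded_mean_def v_def distrib_left)
      also have "\<dots> \<le> real (J * K) * (real N * (rate P x + \<eta> / 2)) + c"
        using rateN by (intro add_right_mono mult_left_mono) auto
      also have "\<dots> = (real (J * K) * real N) * (rate P x + \<eta> / 2) + c"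
        by (simp add: mult.assoc)
      also have "\<dots> \<le> real n * (rate P x + \<eta> / 2) + c"
        using J_le assms by (intro add_right_mono mult_right_mono) (auto intro: add_nonneg_nonneg)
      also have "\<dots> \<le> real n * (rate P x + \<eta>)"
        using elim(1) by (simp add: algebra_simps)
      finally show ?case .
    qed
  qed
qed

lemma upper_tail:
  "AE X in color_law P. \<forall>\<eta>>0. \<forall>\<^sub>F n in sequentially.
    real (passage_time X 0 (floor_site (real n *\<^sub>R x))) \<le> real n * (rate P x + \<eta>)"
proof -
  have "AE X in color_law P. \<forall>k. \<forall>\<^sub>F n in sequentially.
      real (passage_time X 0 (floor_site (real n *\<^sub>R x))) \<le> real n * (rate P x + inverse (real (Suc k)))"
    by (subst AE_all_countable) (auto intro!: upper_tail_fixed)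
  then show ?thesis
  proof (eventually_elim, intro allI impI)
    fix X and \<eta> :: real
    assume X: "\<forall>k. \<forall>\<^sub>F n in sequentially.
        real (passage_time X 0 (floor_site (real n *\<^sub>R x))) \<le> real n * (rate P x + inverse (real (Suc k)))"
      and "\<eta> > 0"
    obtain k where "inverse (real (Suc k)) < \<eta>" using reals_Archimedean[OF \<open>\<eta> > 0\<close>] ..
    then have "real n * (rate P x + inverse (real (Suc k))) \<le> real n * (rate P x + \<eta>)" for n
      by (intro mult_left_mono) auto
    with X[rule_format, of k] show "\<forall>\<^sub>F n in sequentially.
        real (passage_time X 0 (floor_site (real n *\<^sub>R x))) \<le> real n * (rate P x + \<eta>)"
      by (auto elim!: eventually_mono intro: order_trans)
  qed
qed

section \<open>Lower deviations in probability\<close>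

text \<open>
  Up to a bounded rounding error the means lie above \<open>n\<close> times the rate.  Once the excess of
  \<open>T / n\<close> over the rate tends to zero in the mean, there is no room left for a deficit, and Markov's
  inequality concludes.
\<close>

lemma lower_deviation_prob:
  fixes x :: "real ^ 'n::finite"
  assumes "\<eta> > 0"
  shows "(\<lambda>n. measure (color_law P)
    {X. real (passage_time X 0 (floor_site (real n *\<^sub>R x))) < real n * (rate P x - \<eta>)}) \<longlonglongrightarrow> 0"
proof -
  let ?d = "real CARD('n)" and ?m = "rate P x"
  define f where "f n X = real (passage_time X 0 (floor_site (real n *\<^sub>R x))) / real n" for n X
  define excess where "excess n X = max 0 (f n X - ?m)" for n X
  define B where "B = l1norm x + ?d"
  have f_meas [measurable]: "f n \<in> borel_measurable (color_law P)" for n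
    unfolding f_def by measurable
  have f_bound: "0 \<le> f n X" "f n X \<le> B" for n X
  proof -
    have "f n X \<le> B" if "n \<ge> 1"
    proof -
      have "real (passage_time X 0 (floor_site (real n *\<^sub>R x))) \<le> real n * l1norm x + 1 * ?d"
        using passage_time_floor_site_le[of X "real n *\<^sub>R x"] by (simp add: l1norm_scale)
      also have "\<dots> \<le> real n * l1norm x + real n * ?d"
        using that by (intro add_left_mono mult_right_mono) auto
      finally show ?thesis using that by (simp add: f_def B_def field_simps)
    qed
    then show "f n X \<le> B" by (cases "n = 0") (auto simp: f_def B_def)
  qed (simp add: f_def)
  have excess_bound: "0 \<le> excess n X" "excess n X \<le> B" for n X
    using f_bound[of n X] by (auto simp: excess_def intro: order_trans[of _ "f n X"])
  have excess_meas [measurable]: "excess n \<in> borel_measurable (color_law P)" for n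
    unfolding excess_def by measurable
  have f_int: "integrable (color_law P) (f n)" for n
    using f_bound by (intro integrable_bounded[where C=B]) auto
  have excess_int: "integrable (color_law P) (excess n)" for n
    using excess_bound by (intro integrable_bounded[where C=B]) auto
  have "AE X in color_law P. (\<lambda>n. excess n X) \<longlonglongrightarrow> 0"
    using upper_tail[where P=P and x=x]
  proof eventually_elim
    case (elim X)
    show ?case
    proof (rule tendstoI)
      fix e :: real assume "e > 0"
      then have "\<forall>\<^sub>F n in sequentially.
          real (passage_time X 0 (floor_site (real n *\<^sub>R x))) \<le> real n * (rate P x + e / 2)"
        using elim by simp
      then show "\<forall>\<^sub>F n in sequentially. dist (excess n X) 0 < e"
        using eventually_gt_at_top[of 0]
      proof eventually_elim
        case (elim n)
        then have "f n X \<le> ?m + e / 2" by (simp add: f_def field_simps)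
        then show ?case using \<open>e > 0\<close> by (simp add: excess_def)
      qed
    qed
  qed
  then have "(\<lambda>n. \<integral>X. excess n X \<partial>color_law P)
      \<longlonglongrightarrow> (\<integral>X. 0 \<partial>(color_law P :: (int ^ 'n \<Rightarrow> nat) measure))"
    using excess_bound by (intro integral_dominated_convergence[where w="\<lambda>_. B"]) auto
  then have excess_mean: "(\<lambda>n. \<integral>X. excess n X \<partial>color_law P) \<longlonglongrightarrow> 0"
    by simp
  have bound: "measure (color_law P)
      {X. real (passage_time X 0 (floor_site (real n *\<^sub>R x))) < real n * (?m - \<eta>)}
    \<le> (?d / real n + (\<integral>X. excess n X \<partial>color_law P)) / \<eta>" if "n \<ge> 1" for n
  proof -
    define A where "A = {X. f n X < ?m - \<eta>}"
    have A_eq: "{X. real (passage_time X 0 (floor_site (real n *\<^sub>R x))) < real n * (?m - \<eta>)} = A"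
      using that by (auto simp: A_def f_def field_simps)
    have "A = {X \<in> space (color_law P). f n X < ?m - \<eta>}" by (simp add: A_def)
    also have "\<dots> \<in> sets (color_law P)" by measurable
    finally have A_meas: "A \<in> sets (color_law P)" .
    have "\<eta> * measure (color_law P) A = (\<integral>X. \<eta> * indicator A X \<partial>color_law P)"
      using A_meas by simp
    also have "\<dots> \<le> (\<integral>X. ?m - f n X + excess n X \<partial>color_law P)"
    proof (rule integral_mono)
      show "integrable (color_law P) (\<lambda>X. ?m - f n X + excess n X)"
        using f_int excess_int by simp
      show "integrable (color_law P) (\<lambda>X. \<eta> * indicator A X)"
        using A_meas by (simp add: color_law.emeasure_eq_measure)
      show "\<eta> * indicator A X \<le> ?m - f n X + excess n X" for X
        using assms by (auto simp: A_def excess_def indicator_def)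
    qed
    also have "\<dots> = ?m - (\<integral>X. f n X \<partial>color_law P) + (\<integral>X. excess n X \<partial>color_law P)"
      using f_int excess_int by simp
    also have "(\<integral>X. f n X \<partial>color_law P) = mean_time P (floor_site (real n *\<^sub>R x)) / real n"
      by (simp add: f_def mean_time_def)
    also have "?m - mean_time P (floor_site (real n *\<^sub>R x)) / real n \<le> ?d / real n"
      using rate_le[OF that, of P x] by (simp add: padded_mean_def add_divide_distrib)
    finally show ?thesis
      unfolding A_eq using assms by (simp add: field_simps)
  qed
  have "(\<lambda>n. (?d / real n + (\<integral>X. excess n X \<partial>color_law P)) / \<eta>) \<longlonglongrightarrow> (0 + 0) / \<eta>"
    using excess_mean assms by (intro tendsto_intros lim_const_over_n) auto
  then have "(\<lambda>n. (?d / real n + (\<integral>X. excess n X \<partial>color_law P)) / \<eta>) \<longlonglongrightarrow> 0"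
    by simp
  then show ?thesis
  proof (rule tendsto_sandwich[OF _ _ tendsto_const, rotated 2])
    show "\<forall>\<^sub>F n in sequentially. measure (color_law P)
        {X. real (passage_time X 0 (floor_site (real n *\<^sub>R x))) < real n * (?m - \<eta>)}
      \<le> (?d / real n + (\<integral>X. excess n X \<partial>color_law P)) / \<eta>"
      using eventually_ge_at_top[of 1] by eventually_elim (rule bound)
  qed simp
qed

section \<open>Coarse graining of paths\<close>

definition supnorm :: "int ^ 'n::finite \<Rightarrow> int" where
  "supnorm b = Max (range (\<lambda>i. \<bar>b $ i\<bar>))"

lemma supnorm_le_iff: "supnorm b \<le> m \<longleftrightarrow> (\<forall>i. \<bar>b $ i\<bar> \<le> m)"
  by (auto simp: supnorm_def)

lemma component_le_supnorm: "\<bar>b $ i\<bar> \<le> supnorm b"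
  using supnorm_le_iff[of b "supnorm b"] by simp

lemma supnorm_0 [simp]: "supnorm 0 = 0"
  by (simp add: supnorm_def)

lemma supnorm_triangle: "supnorm (a + b) \<le> supnorm a + supnorm b"
  unfolding supnorm_le_iff using component_le_supnorm[of a] component_le_supnorm[of b]
  by (auto intro: order_trans[OF abs_triangle_ineq] add_mono)

lemma supnorm_le_l1norm: "real_of_int (supnorm b) \<le> l1norm (site_vec b)"
proof -
  have "supnorm b \<in> range (\<lambda>i. \<bar>b $ i\<bar>)"
    unfolding supnorm_def by (rule Max_in) auto
  then obtain i where "supnorm b = \<bar>b $ i\<bar>" by blast
  then show ?thesis
    using component_le_l1norm[of "site_vec b" i] by (simp add: site_vec_def)
qed

lemma l1norm_le_supnorm: "l1norm (site_vec b) \<le> real CARD('n) * real_of_int (supnorm b)"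
  for b :: "int ^ 'n::finite"
  using component_le_supnorm[of b] by (intro l1norm_le) (simp add: site_vec_def flip: of_int_abs)

lemma finite_supnorm_le: "finite {b :: int ^ 'n::finite. supnorm b \<le> m}"
proof (rule finite_subset)
  show "{b :: int ^ 'n. supnorm b \<le> m} \<subseteq> vec_lambda ` (UNIV \<rightarrow>\<^sub>E {- m..m})"
  proof
    fix b :: "int ^ 'n" assume "b \<in> {b. supnorm b \<le> m}"
    then have "vec_nth b \<in> UNIV \<rightarrow>\<^sub>E {- m..m}"
      by (auto simp: supnorm_le_iff abs_le_iff PiE_iff minus_le_iff)
    then show "b \<in> vec_lambda ` (UNIV \<rightarrow>\<^sub>E {- m..m})"
      by (metis image_eqI vec_nth_inverse)
  qed
  show "finite (vec_lambda ` ((UNIV :: 'n set) \<rightarrow>\<^sub>E {- m..m}))"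
    by (intro finite_imageI finite_PiE) auto
qed

lemma finite_supnorm: "finite {b :: int ^ 'n::finite. supnorm b = m}"
  by (rule finite_subset[OF _ finite_supnorm_le[of m]]) auto

definition cell :: "nat \<Rightarrow> int ^ 'n::finite \<Rightarrow> int ^ 'n" where
  "cell N u = (\<chi> i. u $ i div int N)"

lemma cell_0 [simp]: "cell N 0 = 0"
  by (simp add: cell_def vec_eq_iff)

definition cell_box :: "nat \<Rightarrow> nat \<Rightarrow> int ^ 'n::finite \<Rightarrow> (int ^ 'n) set" where
  "cell_box N M z = {u. supnorm (cell N u - z) \<le> int M}"

lemma supnorm_cell_adjacent:
  assumes "adjacent u v" "N \<ge> 1"
  shows "supnorm (cell N v - cell N u) \<le> 1"
  unfolding supnorm_le_iff
proof
  fix i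
  have "\<bar>u $ i - v $ i\<bar> \<le> (\<Sum>i\<in>UNIV. \<bar>u $ i - v $ i\<bar>)"
    by (rule member_le_sum) auto
  then have "\<bar>u $ i - v $ i\<bar> \<le> 1"
    using assms by (simp add: adjacent_def)
  then have "v $ i \<le> u $ i + int N" "u $ i \<le> v $ i + int N"
    using assms by auto
  then have "v $ i div int N \<le> (u $ i + int N) div int N" "u $ i div int N \<le> (v $ i + int N) div int N"
    using assms by (simp_all only: zdiv_mono1 of_nat_0_less_iff Suc_le_eq One_nat_def)
  then show "\<bar>(cell N v - cell N u) $ i\<bar> \<le> 1"
    using assms by (simp add: cell_def)
qed

lemma cell_error:
  fixes u :: "int ^ 'n::finite"
  assumes "N \<ge> 1"
  shows "l1norm (site_vec u - real N *\<^sub>R site_vec (cell N u)) \<le> real CARD('n) * real N"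
proof (rule l1norm_le)
  fix i
  have "u $ i - int N * (u $ i div int N) = u $ i mod int N"
    by (simp add: minus_mult_div_eq_mod)
  moreover have "u $ i mod int N < int N" "0 \<le> u $ i mod int N"
    using assms by simp_all
  ultimately have "\<bar>u $ i - int N * (u $ i div int N)\<bar> \<le> int N"
    by linarith
  then have "\<bar>real_of_int (u $ i - int N * (u $ i div int N))\<bar> \<le> real N"
    by linarith
  then show "\<bar>(site_vec u - real N *\<^sub>R site_vec (cell N u)) $ i\<bar> \<le> real N"
    by (simp add: site_vec_def cell_def)
qed

lemma finite_cell_box: "N \<ge> 1 \<Longrightarrow> finite (cell_box N M (0 :: int ^ 'n::finite))"
proof (rule finite_subset[OF _ finite_supnorm_le])
  assume N: "N \<ge> 1"
  show "cell_box N M (0 :: int ^ 'n) \<subseteq> {u. supnorm u \<le> int N * (int M + 1)}"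
  proof
    fix u :: "int ^ 'n" assume "u \<in> cell_box N M 0"
    then have u: "\<bar>u $ i div int N\<bar> \<le> int M" for i
      by (simp add: cell_box_def supnorm_le_iff cell_def)
    have "\<bar>u $ i\<bar> \<le> int N * (int M + 1)" for i
    proof -
      have "\<bar>u $ i\<bar> \<le> \<bar>int N * (u $ i div int N)\<bar> + \<bar>u $ i mod int N\<bar>"
        using abs_triangle_ineq[of "int N * (u $ i div int N)" "u $ i mod int N"] by simp
      also have "\<dots> \<le> int N * int M + int N"
        using N u[of i] unfolding abs_mult by (intro add_mono mult_mono) (auto simp: less_imp_le)
      finally show ?thesis by (simp add: algebra_simps)
    qed
    then show "u \<in> {u. supnorm u \<le> int N * (int M + 1)}"
      by (simp add: supnorm_le_iff)
  qed
qed

text \<open>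
  In units of \<open>N\<close>: moving both end points of a path to the corners of their cells costs at most
  \<open>CARD('n)\<close> each, and \<open>1\<close> is left for the random fluctuation of the passage time between corners.
\<close>

definition corner_cost :: "'n::finite itself \<Rightarrow> real" where
  "corner_cost _ = 2 * real CARD('n) + 1"

text \<open>
  A cell is good when every path that leads from it to distance \<open>M\<close>, in units of \<open>N\<close>, through
  the surrounding box takes at least the time predicted by \<open>f\<close>, up to \<open>corner_cost\<close>.  Confining
  the paths to the box makes the property depend on finitely many sites.
\<close>

definition good_cell ::
    "(real ^ 'n::finite \<Rightarrow> real) \<Rightarrow> nat \<Rightarrow> nat \<Rightarrow> (int ^ 'n \<Rightarrow> nat) \<Rightarrow> int ^ 'n \<Rightarrow> bool" where
  "good_cell f N M X z \<longleftrightarrow> (\<forall>\<gamma>. \<gamma> \<noteq> [] \<longrightarrow> successively adjacent \<gamma> \<longrightarrow> set \<gamma> \<subseteq> cell_box N M z \<longrightarrow>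
     cell N (hd \<gamma>) = z \<longrightarrow> supnorm (cell N (last \<gamma>) - z) = int M \<longrightarrow>
     real N * (f (site_vec (cell N (last \<gamma>) - z)) - corner_cost TYPE('n)) \<le> real (path_time X \<gamma>))"

lemma good_cellD:
  assumes "good_cell f N M X z" "\<gamma> \<noteq> []" "successively adjacent \<gamma>" "set \<gamma> \<subseteq> cell_box N M z"
    "cell N (hd \<gamma>) = z" "supnorm (cell N (last \<gamma>) - z) = int M"
  shows "real N * (f (site_vec (cell N (last \<gamma>) - z)) - corner_cost TYPE('n))
    \<le> real (path_time X (\<gamma> :: (int ^ 'n::finite) list))"
  using assms unfolding good_cell_def by blast

text \<open>
  The renormalisation argument uses the following properties of the rate, which is kept
  abstract since the colouring may follow a law different from the one that defines the rate.
\<close>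

locale equivalent_gauge =
  fixes f :: "real ^ 'n::finite \<Rightarrow> real" and c :: real
  assumes triangle: "f (x + y) \<le> f x + f y"
    and homogeneous: "t \<ge> 0 \<Longrightarrow> f (t *\<^sub>R x) = t * f x"
    and lower: "c * l1norm x \<le> f x"
    and upper: "f x \<le> l1norm x"
    and c_pos: "c > 0"
begin

lemma f_nonneg: "0 \<le> f x"
  using lower[of x] c_pos by (auto intro: order_trans[rotated])

lemma f_step:
  assumes "supnorm b = int M"
  shows "c * real M \<le> f (site_vec b)" "f (site_vec b) \<le> real CARD('n) * real M"
proof -
  have "c * real M \<le> c * l1norm (site_vec b)"
    using supnorm_le_l1norm[of b] assms c_pos by simp
  also have "\<dots> \<le> f (site_vec b)" by (rule lower)
  finally show "c * real M \<le> f (site_vec b)" .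
  have "f (site_vec b) \<le> l1norm (site_vec b)" by (rule upper)
  also have "\<dots> \<le> real CARD('n) * real M"
    using l1norm_le_supnorm[of b] assms by simp
  finally show "f (site_vec b) \<le> real CARD('n) * real M" .
qed

text \<open>
  Starting from the last visit \<open>y\<close> to the current cell, follow the path up to the first vertex \<open>v\<close> whose
  cell is at distance \<open>M\<close>, and repeat from \<open>v\<close>.  As the path never returns to a cell once its last visit is
  over, the cells of the chain are distinct, so that a bad cell is charged only once.  With \<open>g\<close> good and
  \<open>b\<close> bad cells, the passage time is bounded below in two ways: by the number of good cells, each of which
  contributes at least \<open>N (c M - corner_cost)\<close>, and by the distance covered, from which, in units of \<open>N\<close>,
  \<open>corner_cost\<close> is lost at a good cell and \<open>CARD('n) M\<close> at a bad one.
\<close>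

lemma coarse_chain:
  assumes "successively adjacent \<gamma>" "\<gamma> \<noteq> []" and N: "N \<ge> 1" and M: "M \<ge> 1"
  shows "\<exists>zs g b. zs \<noteq> [] \<and> hd zs = cell N (hd \<gamma>) \<and> distinct zs \<and> set zs \<subseteq> cell N ` set \<gamma> \<and>
    successively (\<lambda>z z'. supnorm (z' - z) = int M) zs \<and>
    supnorm (cell N (last \<gamma>) - last zs) < int M \<and>
    g = length (filter (good_cell f N M X) (butlast zs)) \<and>
    b = length (filter (\<lambda>z. \<not> good_cell f N M X z) (butlast zs)) \<and>
    real N * real g * (c * real M - corner_cost TYPE('n)) \<le> real (path_time X \<gamma>) \<and>
    real N * f (site_vec (last zs - hd zs)) \<le> real (path_time X \<gamma>) +
      real N * (real g * corner_cost TYPE('n) + real b * (real CARD('n) * real M))"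
  using assms(1,2)
proof (induction "length \<gamma>" arbitrary: \<gamma> rule: less_induct)
  case less
  let ?C = "corner_cost TYPE('n)" and ?G = "good_cell f N M X"
  define z where "z = cell N (hd \<gamma>)"
  have "\<exists>u\<in>set \<gamma>. cell N u = z"
    using less.prems by (intro bexI[of _ "hd \<gamma>"]) (auto simp: z_def)
  from split_list_last_prop[OF this] obtain \<alpha> y \<beta> where
    \<gamma>: "\<gamma> = \<alpha> @ y # \<beta>" and y: "cell N y = z" and \<beta>: "\<forall>u\<in>set \<beta>. cell N u \<noteq> z"
    by blast
  have adj: "successively adjacent (y # \<beta>)"
    using less.prems(1) by (simp add: \<gamma> successively_append_iff)
  show ?case
  proof (cases "\<exists>v\<in>set \<beta>. supnorm (cell N v - z) \<ge> int M")
    case False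
    have "last \<gamma> \<in> set (y # \<beta>)" using last_in_set[of "y # \<beta>"] by (simp add: \<gamma>)
    then have "supnorm (cell N (last \<gamma>) - z) < int M"
      using False y M by auto
    moreover have "f 0 = 0" using upper[of 0] f_nonneg[of 0] by simp
    ultimately show ?thesis
      using less.prems by (intro exI[of _ "[z]"]) (simp add: z_def)
  next
    case True
    from split_list_first_prop[OF this] obtain \<beta>1 v \<beta>2 where
      \<beta>_eq: "\<beta> = \<beta>1 @ v # \<beta>2" and v: "supnorm (cell N v - z) \<ge> int M"
      and \<beta>1: "\<forall>u\<in>set \<beta>1. \<not> supnorm (cell N u - z) \<ge> int M"
      by blast
    have adj1: "successively adjacent ((y # \<beta>1) @ v # \<beta>2)"
      using adj by (simp add: \<beta>_eq)
    define w where "w = last (y # \<beta>1)"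
    have "w \<in> set (y # \<beta>1)" unfolding w_def by (rule last_in_set) simp
    then have "supnorm (cell N w - z) \<le> int M - 1"
      using \<beta>1 y M by auto
    moreover have "adjacent w v"
      using adj1 unfolding successively_append_iff w_def by simp
    then have "supnorm (cell N v - cell N w) \<le> 1"
      using N by (rule supnorm_cell_adjacent)
    \<comment> \<open>Adjacent sites lie in the same or in neighbouring cells, so the distance cannot jump over \<open>M\<close>.\<close>
    ultimately have vM: "supnorm (cell N v - z) = int M"
      using supnorm_triangle[of "cell N v - cell N w" "cell N w - z"] v by simp
    let ?\<pi> = "y # \<beta>1 @ [v]"
    have \<pi>_box: "set ?\<pi> \<subseteq> cell_box N M z"
      using \<beta>1 y vM by (auto simp: cell_box_def less_imp_le not_le)
    have \<pi>_adj: "successively adjacent ?\<pi>"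
      using adj1 successively_append_iff[of adjacent "y # \<beta>1" "v # \<beta>2"]
        successively_append_iff[of adjacent "y # \<beta>1" "[v]"] by simp
    have adj2: "successively adjacent (v # \<beta>2)"
      using adj1 unfolding successively_append_iff by simp
    have T: "path_time X ?\<pi> + path_time X (v # \<beta>2) \<le> path_time X \<gamma>"
    proof -
      have "path_time X \<gamma> = path_time X (\<alpha> @ [y]) + path_time X ((y # \<beta>1) @ v # \<beta>2)"
        unfolding \<gamma> \<beta>_eq using path_time_append[of X \<alpha> y "\<beta>1 @ v # \<beta>2"] by simp
      also have "path_time X ((y # \<beta>1) @ v # \<beta>2) = path_time X ?\<pi> + path_time X (v # \<beta>2)"
        using path_time_append[of X "y # \<beta>1" v \<beta>2] by simp
      finally show ?thesis by simp
    qed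
    obtain zs g b where zs: "zs \<noteq> []" "hd zs = cell N v" "distinct zs" "set zs \<subseteq> cell N ` set (v # \<beta>2)"
      "successively (\<lambda>z z'. supnorm (z' - z) = int M) zs"
      "supnorm (cell N (last (v # \<beta>2)) - last zs) < int M"
      "g = length (filter ?G (butlast zs))" "b = length (filter (\<lambda>z. \<not> ?G z) (butlast zs))"
      "real N * real g * (c * real M - ?C) \<le> real (path_time X (v # \<beta>2))"
      "real N * f (site_vec (last zs - hd zs)) \<le> real (path_time X (v # \<beta>2)) +
        real N * (real g * ?C + real b * (real CARD('n) * real M))"
      using less.hyps[of "v # \<beta>2"] adj2 by (auto simp: \<gamma> \<beta>_eq)
    let ?s = "f (site_vec (cell N v - z))"
    have f_split: "f (site_vec (last zs - z)) \<le> ?s + f (site_vec (last zs - hd zs))"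
      using triangle[of "site_vec (cell N v - z)" "site_vec (last zs - hd zs)"] by (simp add: zs(2))
    have step: "c * real M \<le> ?s" "?s \<le> real CARD('n) * real M"
      using f_step[OF vM] by auto
    define g' where "g' = (if ?G z then Suc g else g)"
    define b' where "b' = (if ?G z then b else Suc b)"
    have T': "real (path_time X ?\<pi>) + real (path_time X (v # \<beta>2)) \<le> real (path_time X \<gamma>)"
      using T by linarith
    have bounds: "real N * real g' * (c * real M - ?C) \<le> real (path_time X \<gamma>) \<and>
        real N * f (site_vec (last zs - z)) \<le> real (path_time X \<gamma>) +
          real N * (real g' * ?C + real b' * (real CARD('n) * real M))"
    proof (cases "?G z")
      case True
      have good: "real N * (?s - ?C) \<le> real (path_time X ?\<pi>)"
        using good_cellD[OF True _ \<pi>_adj \<pi>_box] y vM by simp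
      have "real N * (c * real M - ?C) \<le> real N * (?s - ?C)"
        using step by (intro mult_left_mono) auto
      moreover have "real N * f (site_vec (last zs - z)) \<le> real N * (?s + f (site_vec (last zs - hd zs)))"
        using f_split by (intro mult_left_mono) auto
      ultimately show ?thesis
        using good T' zs(9,10) True by (simp add: g'_def b'_def algebra_simps)
    next
      case False
      have "real N * f (site_vec (last zs - z)) \<le> real N * (real CARD('n) * real M + f (site_vec (last zs - hd zs)))"
        using f_split step(2) by (intro mult_left_mono) auto
      then show ?thesis
        using T' zs(9,10) False by (simp add: g'_def b'_def algebra_simps)
    qed
    have "z \<notin> set zs"
      using zs(4) \<beta> by (auto simp: \<beta>_eq)
    moreover have "set zs \<subseteq> cell N ` set \<gamma>"
      using zs(4) by (auto simp: \<gamma> \<beta>_eq)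
    moreover have "successively (\<lambda>z z'. supnorm (z' - z) = int M) (z # zs)"
      using zs(1,2,5) vM by (cases zs) auto
    moreover have "z \<in> cell N ` set \<gamma>"
      using y by (auto simp: \<gamma>)
    ultimately show ?thesis
      using zs(1,3,6,7,8) bounds
      by (intro exI[of _ "z # zs"] exI[of _ g'] exI[of _ b'])
         (auto simp: g'_def b'_def z_def \<gamma> \<beta>_eq)
  qed
qed

end

section \<open>Rarity of bad cells\<close>

lemma measurable_good_cell [measurable]:
  "{X. good_cell f N M X z} \<in> sets (color_law P)"
proof -
  have "{X \<in> space (color_law P). good_cell f N M X z} \<in> sets (color_law P)"
    unfolding good_cell_def by measurable
  then show ?thesis by simp
qed

lemma measurable_bad_cell [measurable]:
  "{X. \<not> good_cell f N M X z} \<in> sets (color_law P)"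
  using sets.compl_sets[OF measurable_good_cell[of f N M z P]] by (simp add: Compl_eq_Diff_UNIV [symmetric] Collect_neg_eq)

lemma depends_on_good_cell: "depends_on (cell_box N M z) (\<lambda>X. good_cell f N M X z)"
  unfolding depends_on_def
proof (intro allI impI)
  fix X Y :: "int ^ 'a \<Rightarrow> nat"
  assume eq: "\<forall>u\<in>cell_box N M z. X u = Y u"
  have "path_time X \<gamma> = path_time Y \<gamma>" if "set \<gamma> \<subseteq> cell_box N M z" for \<gamma>
    by (rule depends_onD[OF depends_on_path_time]) (use eq that in auto)
  then show "good_cell f N M X z = good_cell f N M Y z"
    unfolding good_cell_def by (simp cong: imp_cong)
qed

lemma cell_translate: "N \<ge> 1 \<Longrightarrow> cell N (u + int N *s a) = cell N u + a"
  by (simp add: cell_def vec_eq_iff)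

lemma cell_box_translate: "N \<ge> 1 \<Longrightarrow> u + int N *s a \<in> cell_box N M (z + a) \<longleftrightarrow> u \<in> cell_box N M z"
  by (simp add: cell_box_def cell_translate)

lemma good_cell_shift:
  assumes N: "N \<ge> 1"
  shows "good_cell f N M (shift (int N *s z) X) 0 \<longleftrightarrow> good_cell f N M X z"
proof -
  let ?s = "map (\<lambda>u. u + int N *s z)"
  have surj: "\<exists>\<gamma>'. \<gamma> = ?s \<gamma>'" for \<gamma>
    by (rule exI[of _ "map (\<lambda>u. u - int N *s z) \<gamma>"]) (simp add: comp_def)
  have "good_cell f N M X z \<longleftrightarrow>
    (\<forall>\<gamma>'. ?s \<gamma>' \<noteq> [] \<longrightarrow> successively adjacent (?s \<gamma>') \<longrightarrow> set (?s \<gamma>') \<subseteq> cell_box N M z \<longrightarrow>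
      cell N (hd (?s \<gamma>')) = z \<longrightarrow> supnorm (cell N (last (?s \<gamma>')) - z) = int M \<longrightarrow>
      real N * (f (site_vec (cell N (last (?s \<gamma>')) - z)) - corner_cost TYPE('a))
        \<le> real (path_time X (?s \<gamma>')))"
    unfolding good_cell_def by (metis surj)
  also have "\<dots> \<longleftrightarrow> good_cell f N M (shift (int N *s z) X) 0"
    unfolding good_cell_def
  proof (intro all_cong1, goal_cases)
    case (1 \<gamma>')
    have "(set (?s \<gamma>') \<subseteq> cell_box N M z) = (set \<gamma>' \<subseteq> cell_box N M 0)"
      using cell_box_translate[OF N, of _ z M 0] by auto
    then show ?case
      using N by (cases "\<gamma>' = []") (simp_all add: hd_map last_map cell_translate path_time_shift)
  qed
  finally show ?thesis ..
qed

lemma prob_bad_cell: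
  assumes "N \<ge> 1"
  shows "measure (color_law P) {X. \<not> good_cell f N M X z}
    = measure (color_law P) {X. \<not> good_cell f N M X 0}"
  using prob_shift[OF measurable_bad_cell[of f N M 0 P], of "int N *s z"]
  by (simp add: good_cell_shift[OF assms])

fun coarse_walks :: "nat \<Rightarrow> int ^ 'n::finite \<Rightarrow> nat \<Rightarrow> (int ^ 'n) list set" where
  "coarse_walks M z 0 = {[z]}"
| "coarse_walks M z (Suc k) = (\<Union>b\<in>{b. supnorm b = int M}. (#) z ` coarse_walks M (z + b) k)"

lemma card_coarse_walks:
  "finite (coarse_walks M z k) \<and>
   card (coarse_walks M z k) \<le> card {b :: int ^ 'n::finite. supnorm b = int M} ^ k"
  for z :: "int ^ 'n::finite"
proof (induction k arbitrary: z)
  case (Suc k)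
  let ?B = "{b :: int ^ 'n. supnorm b = int M}"
  have fin: "finite ?B" by (rule finite_supnorm)
  have "card (coarse_walks M z (Suc k)) \<le> (\<Sum>b\<in>?B. card ((#) z ` coarse_walks M (z + b) k))"
    using fin by (simp add: card_UN_le)
  also have "\<dots> \<le> (\<Sum>b\<in>?B. card ?B ^ k)"
    using Suc by (intro sum_mono) (meson card_image_le order_trans)
  finally show ?case using Suc fin by simp
qed simp

lemma coarse_walksI:
  assumes "length zs = Suc k" "successively (\<lambda>z z'. supnorm (z' - z) = int M) zs"
  shows "zs \<in> coarse_walks M (hd zs) k"
  using assms
proof (induction k arbitrary: zs)
  case 0
  then show ?case by (cases zs) auto
next
  case (Suc k)
  then obtain z z' zs' where zs: "zs = z # z' # zs'"
    by (cases zs; cases "tl zs") auto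
  then have "z' # zs' \<in> coarse_walks M z' k" "supnorm (z' - z) = int M"
    using Suc.IH[of "z' # zs'"] Suc.prems by auto
  then show ?case
    by (auto simp: zs intro!: exI[of _ "z' - z"])
qed

text \<open>
  Two cells whose coordinates agree modulo \<open>2 M + 1\<close> have disjoint surrounding boxes.
\<close>

definition residue :: "nat \<Rightarrow> int ^ 'n::finite \<Rightarrow> int ^ 'n" where
  "residue M z = (\<chi> i. z $ i mod (2 * int M + 1))"

lemma finite_range_residue: "finite (range (residue M))"
proof (rule finite_subset[OF _ finite_supnorm_le])
  show "range (residue M) \<subseteq> {b. supnorm b \<le> 2 * int M + 1}"
    using pos_mod_bound[of "2 * int M + 1"] pos_mod_sign[of "2 * int M + 1"]
    by (auto simp: residue_def supnorm_le_iff less_imp_le)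
qed

lemma cell_boxes_disjoint:
  assumes "residue M z = residue M z'" "z \<noteq> z'"
  shows "cell_box N M z \<inter> cell_box N M z' = {}"
proof (rule ccontr)
  assume "cell_box N M z \<inter> cell_box N M z' \<noteq> {}"
  then obtain u where u: "supnorm (cell N u - z) \<le> int M" "supnorm (cell N u - z') \<le> int M"
    by (auto simp: cell_box_def)
  obtain i where i: "z $ i \<noteq> z' $ i"
    using assms(2) by (auto simp: vec_eq_iff)
  have "z $ i mod (2 * int M + 1) = z' $ i mod (2 * int M + 1)"
    using assms(1) by (simp add: residue_def vec_eq_iff)
  then have "2 * int M + 1 dvd z $ i - z' $ i"
    by (simp add: mod_eq_dvd_iff)
  then have "2 * int M + 1 \<le> \<bar>z $ i - z' $ i\<bar>"
    using i zdvd_imp_le[of "2 * int M + 1" "\<bar>z $ i - z' $ i\<bar>"] by simp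
  moreover have "\<bar>cell N u $ i - z $ i\<bar> \<le> int M" "\<bar>cell N u $ i - z' $ i\<bar> \<le> int M"
    using u by (simp_all add: supnorm_le_iff)
  ultimately show False by linarith
qed

text \<open>
  Cells with the same residue depend on disjoint sets of sites.  By the pigeonhole principle
  some residue class contains a fixed proportion of the bad cells.
\<close>

lemma large_independent_subset:
  fixes B :: "(int ^ 'n::finite) set"
  assumes "finite B"
  obtains S where "S \<subseteq> B" "disjoint_family_on (cell_box N M) S"
    "real (card B) / real (card (range (residue M :: int ^ 'n \<Rightarrow> _))) \<le> real (card S)"
proof -
  let ?R = "range (residue M :: int ^ 'n \<Rightarrow> _)"
  let ?S = "\<lambda>r. {z \<in> B. residue M z = r}"
  have R: "finite ?R" "?R \<noteq> {}" using finite_range_residue by auto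
  then have R_pos: "card ?R > 0" by (simp add: card_gt_0_iff)
  have "\<exists>r\<in>?R. real (card B) / real (card ?R) \<le> real (card (?S r))"
  proof (rule ccontr)
    assume "\<not> ?thesis"
    then have less: "real (card (?S r)) < real (card B) / real (card ?R)" if "r \<in> ?R" for r
      using that by (auto simp: not_le)
    have "finite (\<Union>r\<in>?R. ?S r)"
      using assms by (rule rev_finite_subset) auto
    then have "card B \<le> card (\<Union>r\<in>?R. ?S r)"
      by (rule card_mono) auto
    also have "\<dots> \<le> (\<Sum>r\<in>?R. card (?S r))"
      using R by (intro card_UN_le)
    finally have "real (card B) \<le> (\<Sum>r\<in>?R. real (card (?S r)))"
      by (simp flip: of_nat_sum)
    also have "\<dots> < (\<Sum>r\<in>?R. real (card B) / real (card ?R))"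
      using R less by (intro sum_strict_mono) auto
    also have "\<dots> = real (card B)"
      using R_pos by simp
    finally show False by simp
  qed
  then obtain r where "real (card B) / real (card ?R) \<le> real (card (?S r))" by blast
  moreover have "disjoint_family_on (cell_box N M) (?S r)"
    unfolding disjoint_family_on_def using cell_boxes_disjoint by blast
  ultimately show thesis by (intro that[of "?S r"]) auto
qed

text \<open>
  A chain of \<open>k\<close> distinct cells with more than \<open>\<delta> k\<close> bad ones contains a set \<open>S\<close> of at least \<open>\<delta>' k\<close> bad cells
  that are independent of each other; for a given \<open>S\<close> this has probability at most \<open>(\<epsilon> powr \<delta>') ^ k\<close>.  There are at most
  \<open>b ^ k\<close> chains and \<open>2 ^ k\<close> sets \<open>S\<close> for each.  With \<open>\<epsilon>\<close> chosen such that \<open>2 b (\<epsilon> powr \<delta>') = 1 / 2\<close> the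
  union bound is summable in \<open>k\<close>.  It matters that \<open>\<epsilon>\<close> depends neither on \<open>N\<close> nor on the law.
\<close>

lemma few_bad_cells:
  fixes M :: nat and \<delta> :: real
  assumes "\<delta> > 0"
  obtains \<epsilon> where "\<epsilon> > 0"
    "\<And>(f :: real ^ 'n::finite \<Rightarrow> real) N P. N \<ge> 1 \<Longrightarrow>
      measure (color_law P) {X. \<not> good_cell f N M X 0} \<le> \<epsilon> \<Longrightarrow>
      AE X in color_law P. \<forall>\<^sub>F k in sequentially. \<forall>zs. length zs = Suc k \<longrightarrow> hd zs = 0 \<longrightarrow>
        distinct zs \<longrightarrow> successively (\<lambda>z z'. supnorm (z' - z) = int M) zs \<longrightarrow>
        real (length (filter (\<lambda>z. \<not> good_cell f N M X z) (butlast zs))) \<le> \<delta> * real k"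
proof -
  define \<delta>' where "\<delta>' = \<delta> / real (card (range (residue M :: int ^ 'n \<Rightarrow> _)))"
  have "card (range (residue M :: int ^ 'n \<Rightarrow> _)) > 0"
    using finite_range_residue by (simp add: card_gt_0_iff)
  then have "\<delta>' > 0" using assms by (simp add: \<delta>'_def)
  \<comment> \<open>The summand \<open>1\<close> ensures \<open>b > 0\<close>.\<close>
  define b where "b = card {b :: int ^ 'n. supnorm b = int M} + 1"
  define \<epsilon> where "\<epsilon> = (1 / (4 * real b)) powr (1 / \<delta>')"
  have "b > 0" by (simp add: b_def)
  have "1 / (4 * real b) \<le> 1" using \<open>b > 0\<close> by simp
  then have \<epsilon>: "\<epsilon> > 0" "\<epsilon> \<le> 1"
    using \<open>b > 0\<close> \<open>\<delta>' > 0\<close> by (auto simp: \<epsilon>_def intro!: powr_le1)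
  have \<epsilon>_powr: "\<epsilon> powr \<delta>' = 1 / (4 * real b)"
    using \<open>b > 0\<close> \<open>\<delta>' > 0\<close> by (simp add: \<epsilon>_def powr_powr)
  show thesis
  proof (rule that[OF \<epsilon>(1)])
    fix f :: "real ^ 'n \<Rightarrow> real" and N P
    assume N: "N \<ge> 1" and bad: "measure (color_law P) {X. \<not> good_cell f N M X 0} \<le> \<epsilon>"
    let ?Bad = "\<lambda>z. {X. \<not> good_cell f N M X z}"
    have bad_z: "measure (color_law P) (?Bad z) \<le> \<epsilon>" for z
      using bad by (subst prob_bad_cell[OF N])
    define I where "I k = (SIGMA zs : coarse_walks M (0 :: int ^ 'n) k.
      {S. S \<subseteq> set (butlast zs) \<and> disjoint_family_on (cell_box N M) S \<and> \<delta>' * real k \<le> real (card S)})" for k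
    define E where "E k = (\<Union>(zs, S)\<in>I k. \<Inter>z\<in>S. ?Bad z)" for k
    have I_sub: "I k \<subseteq> (SIGMA zs : coarse_walks M 0 k. Pow (set (butlast zs)))" for k
      by (auto simp: I_def)
    have len: "length zs = Suc k" if "zs \<in> coarse_walks M z k" for zs k and z :: "int ^ 'n"
      using that by (induction k arbitrary: z zs) auto
    have fin: "finite (SIGMA zs : coarse_walks M (0 :: int ^ 'n) k. Pow (set (butlast zs)))" for k
      using card_coarse_walks[of M "0 :: int ^ 'n" k] by (intro finite_SigmaI) auto
    have I_fin: "finite (I k)" for k
      using finite_subset[OF I_sub fin] .
    have S_fin: "finite S" if "(zs, S) \<in> I k" for zs S k
      using that by (auto simp: I_def intro: finite_subset)
    have I_card: "card (I k) \<le> (2 * b) ^ k" for k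
    proof -
      have "card (I k) \<le> card (SIGMA zs : coarse_walks M (0 :: int ^ 'n) k. Pow (set (butlast zs)))"
        using fin I_sub by (rule card_mono)
      also have "\<dots> = (\<Sum>zs\<in>coarse_walks M (0 :: int ^ 'n) k. card (Pow (set (butlast zs))))"
        using card_coarse_walks[of M "0 :: int ^ 'n" k] by (intro card_SigmaI) auto
      also have "\<dots> \<le> (\<Sum>zs\<in>coarse_walks M (0 :: int ^ 'n) k. 2 ^ k)"
      proof (rule sum_mono)
        fix zs assume "zs \<in> coarse_walks M (0 :: int ^ 'n) k"
        then have "card (set (butlast zs)) \<le> k"
          using card_length[of "butlast zs"] len by force
        then show "card (Pow (set (butlast zs))) \<le> 2 ^ k"
          by (simp add: card_Pow power_increasing)
      qed
      also have "\<dots> \<le> b ^ k * 2 ^ k"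
        using card_coarse_walks[of M "0 :: int ^ 'n" k] power_mono[of "b - 1" b k]
        by (simp add: b_def)
      also have "\<dots> = (2 * b) ^ k"
        by (simp add: power_mult_distrib)
      finally show ?thesis .
    qed
    have meas_S: "(\<Inter>z\<in>S. ?Bad z) \<in> sets (color_law P)" if "finite S" for S
    proof (cases "S = {}")
      case True
      then show ?thesis using sets.top[of "color_law P"] by simp
    next
      case False
      then show ?thesis using that by (intro sets.finite_INT) auto
    qed
    have meas_I: "(case i of (zs, S) \<Rightarrow> \<Inter>z\<in>S. ?Bad z) \<in> sets (color_law P)" if "i \<in> I k" for i k
    proof (cases i)
      case (Pair zs S)
      then have "finite S" using that by (intro S_fin) simp
      then show ?thesis unfolding Pair by (simp only: prod.case meas_S)
    qed
    have meas_E: "E k \<in> sets (color_law P)" for k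
      unfolding E_def by (rule sets.finite_UN[OF I_fin meas_I])
    have prob_S: "measure (color_law P) (\<Inter>z\<in>S. ?Bad z) \<le> (\<epsilon> powr \<delta>') ^ k"
      if "(zs, S) \<in> I k" "k \<ge> 1" for zs S k
    proof -
      have S: "finite S" "disjoint_family_on (cell_box N M) S" "\<delta>' * real k \<le> real (card S)"
        using S_fin[OF that(1)] that(1) by (simp_all add: I_def)
      have "0 < \<delta>' * real k" using \<open>\<delta>' > 0\<close> that by simp
      then have "S \<noteq> {}" using S by auto
      have "measure (color_law P) (\<Inter>z\<in>S. ?Bad z) = (\<Prod>z\<in>S. measure (color_law P) (?Bad z))"
      proof (rule prob_INT_disjoint_dependence[OF _ _ S(2,1) \<open>S \<noteq> {}\<close>])
        show "depends_on (cell_box N M z) (\<lambda>X. X \<in> ?Bad z)" for z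
          using depends_on_good_cell[of N M z f] by (auto simp: depends_on_def)
      qed measurable
      also have "\<dots> \<le> (\<Prod>z\<in>S. \<epsilon>)"
        using bad_z by (intro prod_mono) simp
      also have "\<dots> = \<epsilon> powr real (card S)"
        using \<epsilon> by (simp add: powr_realpow)
      also have "\<dots> \<le> \<epsilon> powr (\<delta>' * real k)"
        using \<epsilon> S(3) by (intro powr_mono') auto
      also have "\<dots> = (\<epsilon> powr \<delta>') ^ k"
        using \<epsilon> by (simp add: powr_powr [symmetric] powr_realpow)
      finally show ?thesis .
    qed
    have prob_E: "measure (color_law P) (E k) \<le> (1 / 2) ^ k" if "k \<ge> 1" for k
    proof -
      have "measure (color_law P) (E k)
          \<le> (\<Sum>i\<in>I k. measure (color_law P) (case i of (zs, S) \<Rightarrow> \<Inter>z\<in>S. ?Bad z))"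
        unfolding E_def using I_fin meas_I
        by (intro color_law.finite_measure_subadditive_finite) blast+
      also have "\<dots> \<le> (\<Sum>i\<in>I k. (\<epsilon> powr \<delta>') ^ k)"
        using prob_S that by (intro sum_mono) (simp only: split_paired_all prod.case)
      also have "\<dots> = real (card (I k)) * (\<epsilon> powr \<delta>') ^ k"
        by simp
      also have "\<dots> \<le> real ((2 * b) ^ k) * (\<epsilon> powr \<delta>') ^ k"
        using I_card[of k] by (intro mult_right_mono) (simp_all only: of_nat_le_iff zero_le_power powr_ge_zero)
      also have "\<dots> = (2 * real b * (\<epsilon> powr \<delta>')) ^ k"
        by (simp add: power_mult_distrib)
      also have "2 * real b * (\<epsilon> powr \<delta>') = 1 / 2"
        using \<open>b > 0\<close> by (simp add: \<epsilon>_powr)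
      finally show ?thesis .
    qed
    have "summable (\<lambda>k. measure (color_law P) (E k))"
    proof (rule summable_comparison_test')
      show "summable (\<lambda>k. (1 / 2 :: real) ^ k)" by (simp add: summable_geometric)
      show "norm (measure (color_law P) (E k)) \<le> (1 / 2) ^ k" if "k \<ge> 1" for k
        using prob_E[OF that] by simp
    qed
    then have "AE X in color_law P. \<forall>\<^sub>F k in sequentially. X \<in> space (color_law P) - E k"
      using meas_E by (intro borel_cantelli_AE1) (auto simp: color_law.emeasure_eq_measure)
    then show "AE X in color_law P. \<forall>\<^sub>F k in sequentially. \<forall>zs. length zs = Suc k \<longrightarrow> hd zs = 0 \<longrightarrow>
        distinct zs \<longrightarrow> successively (\<lambda>z z'. supnorm (z' - z) = int M) zs \<longrightarrow>
        real (length (filter (\<lambda>z. \<not> good_cell f N M X z) (butlast zs))) \<le> \<delta> * real k"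
    proof eventually_elim
      case (elim X)
      then show ?case
      proof eventually_elim
        case (elim k)
        have False if zs: "length zs = Suc k" "hd zs = 0" "distinct zs"
            "successively (\<lambda>z z'. supnorm (z' - z) = int M) zs"
          and many: "\<not> real (length (filter (\<lambda>z. \<not> good_cell f N M X z) (butlast zs))) \<le> \<delta> * real k"
          for zs :: "(int ^ 'n) list"
        proof -
          let ?F = "filter (\<lambda>z. \<not> good_cell f N M X z) (butlast zs)"
          obtain S where S: "S \<subseteq> set ?F" "disjoint_family_on (cell_box N M) S"
            "real (card (set ?F)) / real (card (range (residue M :: int ^ 'n \<Rightarrow> _))) \<le> real (card S)"
            using large_independent_subset[of "set ?F" N M] by auto
          have "distinct ?F"
            using zs(3) by (simp add: distinct_butlast)
          then have "card (set ?F) = length ?F"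
            by (rule distinct_card)
          then have "\<delta>' * real k \<le> real (card (set ?F)) / real (card (range (residue M :: int ^ 'n \<Rightarrow> _)))"
            using many by (simp add: \<delta>'_def divide_right_mono)
          also note S(3)
          finally have "(zs, S) \<in> I k"
            using S(1,2) coarse_walksI[OF zs(1,4)] zs(2) by (auto simp: I_def)
          moreover have "X \<in> (\<Inter>z\<in>S. ?Bad z)"
            using S(1) by auto
          ultimately have "X \<in> E k" unfolding E_def by blast
          with elim show False by simp
        qed
        then show ?case by blast
      qed
    qed
  qed
qed

text \<open>
  Extending a fast crossing to the corners of the cells at both of its ends gives a fast path
  from \<open>0\<close> to \<open>N b\<close>, where \<open>b\<close> is one of finitely many directions that do not depend on \<open>N\<close>.
\<close>

lemma bad_corner_passage_time:
  assumes "\<not> good_cell f N M X 0" and N: "N \<ge> 1"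
  shows "\<exists>b. supnorm b = int M \<and>
    real (passage_time X 0 (int N *s b)) < real N * (f (site_vec b) - 1)"
proof -
  from assms(1) obtain \<gamma> :: "(int ^ 'a) list" where
    \<gamma>: "\<gamma> \<noteq> []" "successively adjacent \<gamma>" "cell N (hd \<gamma>) = 0" "supnorm (cell N (last \<gamma>) - 0) = int M"
      "real (path_time X \<gamma>) < real N * (f (site_vec (cell N (last \<gamma>))) - corner_cost TYPE('a))"
    unfolding good_cell_def by (auto simp: not_le)
  let ?b = "cell N (last \<gamma>)"
  have "real (passage_time X 0 (int N *s ?b)) \<le> real (passage_time X (hd \<gamma>) (last \<gamma>)) +
      l1norm (site_vec 0 - site_vec (hd \<gamma>)) + l1norm (site_vec (int N *s ?b) - site_vec (last \<gamma>))"
    by (rule passage_time_lipschitz)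
  also have "real (passage_time X (hd \<gamma>) (last \<gamma>)) \<le> real (path_time X \<gamma>)"
    using \<gamma>(1,2) by (simp add: passage_time_le paths_iff)
  also have "l1norm (site_vec 0 - site_vec (hd \<gamma>)) \<le> real CARD('a) * real N"
    using cell_error[OF N, of "hd \<gamma>"] \<gamma>(3) by (simp add: l1norm_minus_commute[of 0] l1norm_def)
  also have "l1norm (site_vec (int N *s ?b) - site_vec (last \<gamma>)) \<le> real CARD('a) * real N"
    using cell_error[OF N, of "last \<gamma>"] by (simp add: l1norm_minus_commute)
  also note \<gamma>(5)
  finally have "real (passage_time X 0 (int N *s ?b)) < real N * (f (site_vec ?b) - 1)"
    by (simp add: corner_cost_def algebra_simps)
  then show ?thesis using \<gamma>(4) by auto
qed

lemma prob_bad_cell_tendsto_0: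
  "(\<lambda>N. measure (color_law P) {X. \<not> good_cell (rate P) N M X (0 :: int ^ 'n::finite)}) \<longlonglongrightarrow> 0"
proof (rule tendsto_sandwich[OF _ _ tendsto_const])
  let ?S = "{b :: int ^ 'n. supnorm b = int M}"
  let ?A = "\<lambda>N b. {X. real (passage_time X 0 (floor_site (real N *\<^sub>R site_vec b)))
    < real N * (rate P (site_vec b :: real ^ 'n) - 1)}"
  show "(\<lambda>N. \<Sum>b\<in>?S. measure (color_law P) (?A N b)) \<longlonglongrightarrow> 0"
    by (intro tendsto_null_sum lower_deviation_prob) simp
  show "\<forall>\<^sub>F N in sequentially. measure (color_law P) {X. \<not> good_cell (rate P) N M X (0 :: int ^ 'n)}
      \<le> (\<Sum>b\<in>?S. measure (color_law P) (?A N b))"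
    using eventually_ge_at_top[of 1]
  proof eventually_elim
    case (elim N)
    have fl: "floor_site (real N *\<^sub>R site_vec b) = int N *s b" for b :: "int ^ 'n"
      using floor_site_site_vec[of "int N *s b"] by simp
    have meas: "?A N b \<in> sets (color_law P)" for b
    proof -
      have "{X \<in> space (color_law P). real (passage_time X 0 (floor_site (real N *\<^sub>R site_vec b)))
        < real N * (rate P (site_vec b :: real ^ 'n) - 1)} \<in> sets (color_law P)"
        by measurable
      then show ?thesis by simp
    qed
    have "measure (color_law P) {X. \<not> good_cell (rate P) N M X (0 :: int ^ 'n)}
        \<le> measure (color_law P) (\<Union>b\<in>?S. ?A N b)"
    proof (rule color_law.finite_measure_mono)
      show "{X. \<not> good_cell (rate P) N M X (0 :: int ^ 'n)} \<subseteq> (\<Union>b\<in>?S. ?A N b)"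
        using bad_corner_passage_time[OF _ elim, of "rate P"] by (auto simp: fl)
      show "(\<Union>b\<in>?S. ?A N b) \<in> sets (color_law P)"
        by (intro sets.finite_UN finite_supnorm meas)
    qed
    also have "\<dots> \<le> (\<Sum>b\<in>?S. measure (color_law P) (?A N b))"
      using meas by (intro color_law.finite_measure_subadditive_finite finite_supnorm) auto
    finally show ?case .
  qed
qed simp

section \<open>The lower bound\<close>

context equivalent_gauge
begin

text \<open>
  Let \<open>a = c M - C\<close>, the guaranteed time per good cell.  A chain with at most \<open>\<delta> k\<close> bad cells has
  \<open>b \<le> 2 \<delta> g\<close>, so the loss \<open>g C + b d M\<close> in the distance estimate of \<open>coarse_chain\<close> is at most
  \<open>g (C + 2 \<delta> d M)\<close>.  For \<open>M\<close> large and \<open>\<delta>\<close> small this is at most \<open>\<theta> g a\<close>, hence at most \<open>\<theta> T / N\<close> by the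
  first estimate.  Chains shorter than the random length \<open>k0\<close> from which the bad cells are few only
  contribute to the constant \<open>K\<close>.
\<close>

lemma lower_bound:
  assumes "\<theta> > 0"
  obtains M \<epsilon> where "\<epsilon> > 0"
    "\<And>N P. N \<ge> 1 \<Longrightarrow> measure (color_law P) {X. \<not> good_cell f N M X 0} \<le> \<epsilon> \<Longrightarrow>
      AE X in color_law P. \<exists>K. \<forall>w. f (site_vec w) \<le> (1 + \<theta>) * real (passage_time X 0 w) + K"
proof -
  let ?C = "corner_cost TYPE('n)" and ?d = "real CARD('n)"
  have C: "?C > 0" and d: "?d > 0" by (simp_all add: corner_cost_def)
  define \<delta> where "\<delta> = min (1 / 2) (c * \<theta> / (8 * ?d))"
  have \<delta>: "\<delta> > 0" "\<delta> \<le> 1 / 2" "\<delta> \<le> c * \<theta> / (8 * ?d)"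
    using c_pos assms d by (auto simp: \<delta>_def)
  obtain M0 :: nat where M0: "max (2 * ?C / c) (4 * ?C / (c * \<theta>)) < real M0"
    using reals_Archimedean2 by blast
  define M where "M = max 1 M0"
  have M: "M \<ge> 1" "2 * ?C \<le> c * real M" "4 * ?C \<le> c * real M * \<theta>"
  proof -
    have "2 * ?C / c \<le> real M" "4 * ?C / (c * \<theta>) \<le> real M"
      using M0 by (auto simp: M_def)
    then show "2 * ?C \<le> c * real M" "4 * ?C \<le> c * real M * \<theta>"
      using c_pos assms by (simp_all add: pos_divide_le_eq mult_ac)
  qed (simp add: M_def)
  define a where "a = c * real M - ?C"
  have a: "a > 0" "c * real M \<le> 2 * a"
    using M(2) C by (simp_all add: a_def)
  have cost: "?C + 2 * \<delta> * (?d * real M) \<le> \<theta> * a"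
  proof -
    have "8 * \<delta> * ?d \<le> c * \<theta>"
      using \<delta>(3) d by (simp add: pos_le_divide_eq mult_ac)
    then have "8 * \<delta> * ?d * real M \<le> c * \<theta> * real M"
      by (intro mult_right_mono) auto
    moreover have "c * real M * \<theta> \<le> 2 * a * \<theta>"
      using a(2) assms by (intro mult_right_mono) auto
    ultimately show ?thesis using M(3) by (simp add: mult_ac)
  qed
  obtain \<epsilon> where "\<epsilon> > 0" and few:
    "\<And>(f :: real ^ 'n \<Rightarrow> real) N P. N \<ge> 1 \<Longrightarrow>
      measure (color_law P) {X. \<not> good_cell f N M X 0} \<le> \<epsilon> \<Longrightarrow>
      AE X in color_law P. \<forall>\<^sub>F k in sequentially. \<forall>zs. length zs = Suc k \<longrightarrow> hd zs = 0 \<longrightarrow>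
        distinct zs \<longrightarrow> successively (\<lambda>z z'. supnorm (z' - z) = int M) zs \<longrightarrow>
        real (length (filter (\<lambda>z. \<not> good_cell f N M X z) (butlast zs))) \<le> \<delta> * real k"
    by (rule few_bad_cells[OF \<delta>(1), of M]) (rule that)
  show thesis
  proof (rule that[OF \<open>\<epsilon> > 0\<close>])
    fix N P assume N: "N \<ge> 1" and bad: "measure (color_law P) {X. \<not> good_cell f N M X 0} \<le> \<epsilon>"
    from few[OF N bad]
    show "AE X in color_law P. \<exists>K. \<forall>w. f (site_vec w) \<le> (1 + \<theta>) * real (passage_time X 0 w) + K"
    proof eventually_elim
      case (elim X)
      then obtain k0 where k0: "\<And>k zs. k \<ge> k0 \<Longrightarrow> length zs = Suc k \<Longrightarrow> hd zs = 0 \<Longrightarrow>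
        distinct zs \<Longrightarrow> successively (\<lambda>z z'. supnorm (z' - z) = int M) zs \<Longrightarrow>
        real (length (filter (\<lambda>z. \<not> good_cell f N M X z) (butlast zs))) \<le> \<delta> * real k"
        unfolding eventually_sequentially by blast
      define K where "K = real N * (real k0 * (?C + ?d * real M)) + ?d * (real N * real M)"
      have "f (site_vec w) \<le> (1 + \<theta>) * real (passage_time X 0 w) + K" for w
      proof -
        obtain \<gamma> where \<gamma>: "\<gamma> \<in> paths 0 w" "path_time X \<gamma> = passage_time X 0 w"
          by (rule geodesic_exists)
        define T where "T = real (passage_time X 0 w)"
        have "T \<ge> 0" by (simp add: T_def)
        have "successively adjacent \<gamma>" "\<gamma> \<noteq> []" "hd \<gamma> = 0" "last \<gamma> = w"
          using \<gamma>(1) by (auto simp: paths_iff)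
        then have "\<exists>zs g b. zs \<noteq> [] \<and> hd zs = 0 \<and> distinct zs \<and> set zs \<subseteq> cell N ` set \<gamma> \<and>
          successively (\<lambda>z z'. supnorm (z' - z) = int M) zs \<and>
          supnorm (cell N w - last zs) < int M \<and>
          g = length (filter (good_cell f N M X) (butlast zs)) \<and>
          b = length (filter (\<lambda>z. \<not> good_cell f N M X z) (butlast zs)) \<and>
          real N * real g * a \<le> T \<and>
          real N * f (site_vec (last zs - hd zs)) \<le> T + real N * (real g * ?C + real b * (?d * real M))"
          using coarse_chain[OF _ _ N M(1), of \<gamma> X] \<gamma>(2) unfolding a_def T_def by simp
        then obtain zs g b where zs: "zs \<noteq> []" "hd zs = 0" "distinct zs"
          "successively (\<lambda>z z'. supnorm (z' - z) = int M) zs"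
          "supnorm (cell N w - last zs) < int M"
          "g = length (filter (good_cell f N M X) (butlast zs))"
          "b = length (filter (\<lambda>z. \<not> good_cell f N M X z) (butlast zs))"
          "real N * real g * a \<le> T"
          "real N * f (site_vec (last zs - hd zs)) \<le> T + real N * (real g * ?C + real b * (?d * real M))"
          by blast
        have zs9: "real N * f (site_vec (last zs)) \<le> T + real N * (real g * ?C + real b * (?d * real M))"
          using zs(9) unfolding zs(2) by simp
        define k where "k = length (butlast zs)"
        have gb: "g + b = k"
          unfolding zs(6,7) k_def by (rule sum_length_filter_compl)
        have len: "length zs = Suc k" using zs(1) by (simp add: k_def)
        have end_error: "f (site_vec w) \<le> real N * f (site_vec (last zs)) + ?d * (real N * real M)"
        proof -
          have "l1norm (site_vec w - real N *\<^sub>R site_vec (last zs)) \<le> ?d * (real N * real M)"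
          proof (rule l1norm_le)
            fix i
            let ?q = "w $ i div int N" and ?z = "last zs $ i"
            have "\<bar>?q - ?z\<bar> \<le> supnorm (cell N w - last zs)"
              using component_le_supnorm[of "cell N w - last zs" i] by (simp add: cell_def)
            then have q: "\<bar>?q - ?z\<bar> \<le> int M - 1" using zs(5) by linarith
            have "w $ i = int N * ?q + w $ i mod int N" by simp
            moreover have "0 \<le> w $ i mod int N" "w $ i mod int N < int N" using N by simp_all
            ultimately have r: "\<bar>w $ i - int N * ?q\<bar> \<le> int N" by linarith
            have "\<bar>w $ i - int N * ?z\<bar> \<le> \<bar>w $ i - int N * ?q\<bar> + \<bar>int N * (?q - ?z)\<bar>"
              by (simp add: algebra_simps)
            also have "\<dots> \<le> int N + int N * (int M - 1)"
              using r q unfolding abs_mult by (intro add_mono mult_mono) auto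
            also have "\<dots> = int N * int M" by (simp add: algebra_simps)
            finally have "\<bar>real_of_int (w $ i - int N * ?z)\<bar> \<le> real_of_int (int N * int M)"
              by linarith
            then show "\<bar>(site_vec w - real N *\<^sub>R site_vec (last zs)) $ i\<bar> \<le> real N * real M"
              by (simp add: site_vec_def)
          qed
          then show ?thesis
            using triangle[of "real N *\<^sub>R site_vec (last zs)" "site_vec w - real N *\<^sub>R site_vec (last zs)"]
              upper[of "site_vec w - real N *\<^sub>R site_vec (last zs)"]
              homogeneous[of "real N" "site_vec (last zs)"] by simp
        qed
        have "f (site_vec w) \<le> (1 + \<theta>) * T + K"
        proof (cases "k \<ge> k0")
          case True
          have "real b \<le> \<delta> * real k"
            using k0[OF True len zs(2-4)] by (simp add: zs(7))
          also have "real k = real g + real b" using gb by simp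
          finally have b: "real b \<le> \<delta> * real g + \<delta> * real b" by (simp add: distrib_left)
          have "\<delta> * real b \<le> 1 / 2 * real b"
            using \<delta>(2) by (intro mult_right_mono) auto
          then have "real b \<le> 2 * \<delta> * real g" using b by simp
          then have "real b * (?d * real M) \<le> 2 * \<delta> * real g * (?d * real M)"
            by (intro mult_right_mono) auto
          then have "real g * ?C + real b * (?d * real M) \<le> real g * (?C + 2 * \<delta> * (?d * real M))"
            by (simp add: algebra_simps)
          also have "\<dots> \<le> real g * (\<theta> * a)"
            using cost by (intro mult_left_mono) auto
          finally have "real N * (real g * ?C + real b * (?d * real M)) \<le> real N * (real g * (\<theta> * a))"
            by (intro mult_left_mono) auto
          also have "\<dots> = \<theta> * (real N * real g * a)" by simp
          also have "\<dots> \<le> \<theta> * T" using zs(8) assms by (intro mult_left_mono) auto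
          finally have "f (site_vec w) \<le> T + \<theta> * T + ?d * (real N * real M)"
            using zs9 end_error by linarith
          moreover have "0 \<le> real N * (real k0 * (?C + ?d * real M))" using C by simp
          ultimately show ?thesis by (simp add: K_def algebra_simps)
        next
          case False
          have "real g * ?C + real b * (?d * real M) \<le> real k0 * ?C + real k0 * (?d * real M)"
            using False gb C by (intro add_mono mult_right_mono) auto
          then have "real N * (real g * ?C + real b * (?d * real M)) \<le> real N * (real k0 * (?C + ?d * real M))"
            by (intro mult_left_mono) (auto simp: distrib_left)
          moreover have "0 \<le> \<theta> * T" using assms \<open>T \<ge> 0\<close> by simp
          ultimately show ?thesis
            using zs9 end_error unfolding K_def distrib_right by linarith
        qed
        then show ?thesis by (simp add: T_def)
      qed
      then show ?case by blast
    qed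
  qed
qed

end

section \<open>Identification of the time constant\<close>

text \<open>
  A continuous function that is positive on the compact unit sphere is bounded away from \<open>0\<close> there.
\<close>

lemma rate_gauge:
  assumes "\<And>x :: real ^ 'n::finite. x \<noteq> 0 \<Longrightarrow> rate P x \<noteq> 0"
  obtains c where "equivalent_gauge (rate P :: real ^ 'n \<Rightarrow> real) c"
proof -
  let ?S = "sphere (0 :: real ^ 'n) 1" and ?d = "real CARD('n)"
  have "?d-lipschitz_on UNIV (rate P :: real ^ 'n \<Rightarrow> real)"
  proof (rule lipschitz_onI)
    fix x y :: "real ^ 'n"
    have "\<bar>rate P x - rate P y\<bar> \<le> l1norm (x - y)"
      using rate_lipschitz[of P x y] rate_lipschitz[of P y x] by (simp add: l1norm_minus_commute)
    also have "\<dots> \<le> ?d * norm (x - y)" by (rule l1norm_le_norm)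
    finally show "dist (rate P x) (rate P y) \<le> ?d * dist x y"
      by (simp add: dist_norm)
  qed simp
  then have "continuous_on ?S (rate P :: real ^ 'n \<Rightarrow> real)"
    using lipschitz_on_continuous_on lipschitz_on_subset by blast
  moreover have "?S \<noteq> {}" by simp
  ultimately obtain x0 where x0: "x0 \<in> ?S" "\<And>x. x \<in> ?S \<Longrightarrow> rate P x0 \<le> rate P x"
    using continuous_attains_inf[of ?S "rate P"] by auto
  have "x0 \<noteq> 0" using x0(1) by auto
  define c where "c = rate P x0 / ?d"
  have "rate P x0 > 0"
    using \<open>x0 \<noteq> 0\<close> assms[of x0] by (simp add: less_le)
  then have "c > 0" by (simp add: c_def)
  moreover have "c * l1norm x \<le> rate P x" for x :: "real ^ 'n"
  proof (cases "x = 0")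
    case True
    then show ?thesis by simp
  next
    case False
    have "c * l1norm x \<le> c * (?d * norm x)"
      using \<open>c > 0\<close> l1norm_le_norm[of x] by (intro mult_left_mono) auto
    also have "\<dots> = norm x * rate P x0" by (simp add: c_def)
    also have "\<dots> \<le> norm x * rate P ((1 / norm x) *\<^sub>R x)"
      using False by (intro mult_left_mono x0(2)) auto
    also have "\<dots> = rate P x"
      using False by (simp add: rate_scale)
    finally show ?thesis .
  qed
  ultimately have "equivalent_gauge (rate P :: real ^ 'n \<Rightarrow> real) c"
    by unfold_locales (auto intro: rate_triangle rate_scale rate_le_l1norm)
  then show thesis by (rule that)
qed

lemma nearest_site_error:
  fixes s :: "real ^ 'n::finite \<Rightarrow> int ^ 'n"
  assumes "nearest_site_rule s"
  shows "l1norm (site_vec (s x) - x) \<le> real CARD('n) * real CARD('n)"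
proof -
  have "dist x (site_vec (s x)) \<le> dist x (site_vec (floor_site x))"
    using assms by (simp add: nearest_site_rule_def)
  also have "\<dots> \<le> l1norm (site_vec (floor_site x) - x)"
    using norm_le_l1norm[of "site_vec (floor_site x) - x"] by (simp add: dist_norm norm_minus_commute)
  also have "\<dots> \<le> real CARD('n)" by (rule floor_site_error)
  finally have "norm (site_vec (s x) - x) \<le> real CARD('n)"
    by (simp add: dist_norm norm_minus_commute)
  then show ?thesis
    using l1norm_le_norm[of "site_vec (s x) - x"] mult_left_mono[of "norm (site_vec (s x) - x)" "real CARD('n)" "real CARD('n)"]
    by linarith
qed

text \<open>
  The tie-breaking rule moves both end points by a bounded amount, which is invisible after
  division by \<open>n\<close>.
\<close>

lemma scaled_time_independent_of_rounding:
  fixes s :: "real ^ 'n::finite \<Rightarrow> int ^ 'n"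
  assumes s: "nearest_site_rule s"
  shows "(\<lambda>n. real (passage_time X (s 0) (s (real n *\<^sub>R x))) / real n) \<longlonglongrightarrow> m \<longleftrightarrow>
    (\<lambda>n. real (passage_time X 0 (floor_site (real n *\<^sub>R x))) / real n) \<longlonglongrightarrow> m"
proof -
  let ?d = "real CARD('n)"
  define c where "c = 2 * (?d * ?d) + ?d"
  let ?f = "\<lambda>n. real (passage_time X (s 0) (s (real n *\<^sub>R x)))"
  let ?g = "\<lambda>n. real (passage_time X 0 (floor_site (real n *\<^sub>R x)))"
  have bound: "\<bar>?f n - ?g n\<bar> \<le> c" for n
  proof -
    let ?y = "real n *\<^sub>R x"
    have 1: "l1norm (site_vec (s 0) - site_vec 0) \<le> ?d * ?d"
      using nearest_site_error[OF s, of 0] by simp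
    have 2: "l1norm (site_vec (s ?y) - site_vec (floor_site ?y)) \<le> ?d * ?d + ?d"
      using l1norm_triangle_diff[of "site_vec (s ?y)" "site_vec (floor_site ?y)" ?y]
        nearest_site_error[OF s, of ?y] floor_site_error[of ?y]
      by (simp add: l1norm_minus_commute[of ?y])
    show ?thesis
      using 1 2 passage_time_lipschitz[of X "s 0" "s ?y" 0 "floor_site ?y"]
        passage_time_lipschitz[of X 0 "floor_site ?y" "s 0" "s ?y"]
      unfolding l1norm_minus_commute[of "site_vec 0"] l1norm_minus_commute[of "site_vec (floor_site ?y)"]
        c_def by linarith
  qed
  have "(\<lambda>n. ?f n / real n - ?g n / real n) \<longlonglongrightarrow> 0"
  proof (rule Lim_null_comparison)
    show "\<forall>\<^sub>F n in sequentially. norm (?f n / real n - ?g n / real n) \<le> c / real n"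
      using bound by (auto simp: diff_divide_distrib [symmetric] divide_right_mono)
  qed (rule lim_const_over_n)
  from this tendsto_minus[OF this] show ?thesis
    using Lim_transform[of "\<lambda>n. ?g n / real n" m sequentially "\<lambda>n. ?f n / real n"]
      Lim_transform[of "\<lambda>n. ?f n / real n" m sequentially "\<lambda>n. ?g n / real n"]
    by (auto simp: algebra_simps)
qed

lemma time_constant_eqI:
  fixes s :: "real ^ 'n::finite \<Rightarrow> int ^ 'n"
  assumes "nearest_site_rule s"
    and lim: "AE X in coloring_law p.
      (\<lambda>n. real (passage_time X 0 (floor_site (real n *\<^sub>R x))) / real n) \<longlonglongrightarrow> m"
  shows "time_constant s p x = m"
  unfolding time_constant_def scaled_time_independent_of_rounding[OF assms(1)]
proof (rule the_equality)
  show "AE X in coloring_law p.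
      (\<lambda>n. real (passage_time X 0 (floor_site (real n *\<^sub>R x))) / real n) \<longlonglongrightarrow> m"
    by (rule lim)
  fix m' assume "AE X in coloring_law p.
      (\<lambda>n. real (passage_time X 0 (floor_site (real n *\<^sub>R x))) / real n) \<longlonglongrightarrow> m'"
  with lim have "AE X in (coloring_law p :: (int ^ 'n \<Rightarrow> nat) measure). m' = m"
    by eventually_elim (rule LIMSEQ_unique)
  then show "m' = m"
    unfolding coloring_law_def by simp
qed

text \<open>
  Passage times are nonnegative, hence the upper tail suffices where the rate vanishes.
\<close>

lemma time_constant_zero:
  assumes "nearest_site_rule s" and "rate (embed_pmf p) x = 0"
  shows "time_constant s p x = 0"
proof (rule time_constant_eqI[OF assms(1)])
  show "AE X in coloring_law p.
      (\<lambda>n. real (passage_time X 0 (floor_site (real n *\<^sub>R x))) / real n) \<longlonglongrightarrow> 0"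
    unfolding coloring_law_def using upper_tail[where P = "embed_pmf p" and x = x]
  proof eventually_elim
    case (elim X)
    show ?case
    proof (rule tendstoI)
      fix e :: real assume "e > 0"
      then have "\<forall>\<^sub>F n in sequentially.
          real (passage_time X 0 (floor_site (real n *\<^sub>R x))) \<le> real n * (0 + e / 2)"
        using elim[rule_format, of "e / 2"] assms(2) by simp
      then show "\<forall>\<^sub>F n in sequentially.
          dist (real (passage_time X 0 (floor_site (real n *\<^sub>R x))) / real n) 0 < e"
        using eventually_gt_at_top[of 0]
      proof eventually_elim
        case (elim n)
        then have "real (passage_time X 0 (floor_site (real n *\<^sub>R x))) / real n \<le> e / 2"
          by (simp add: pos_divide_le_eq mult.commute)
        also have "\<dots> < e" using \<open>e > 0\<close> by simp
        finally show ?case by simp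
      qed
    qed
  qed
qed

lemma lower_tail_from_lower_bound:
  assumes g: "equivalent_gauge f c" and "\<theta> > 0"
    and K: "\<And>w. f (site_vec w) \<le> (1 + \<theta>) * real (passage_time X 0 w) + K"
    and "\<eta> > 0"
  shows "\<forall>\<^sub>F n in sequentially.
    f x \<le> (1 + \<theta>) * (real (passage_time X 0 (floor_site (real n *\<^sub>R x))) / real n) + \<eta>"
proof -
  interpret equivalent_gauge f c by (rule g)
  let ?d = "real CARD('a)"
  have "(\<lambda>n. (K + ?d) / real n) \<longlonglongrightarrow> 0" by (rule lim_const_over_n)
  then have "\<forall>\<^sub>F n in sequentially. (K + ?d) / real n < \<eta>"
    using \<open>\<eta> > 0\<close> by (rule order_tendstoD(2))
  then show ?thesis
    using eventually_gt_at_top[of 0]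
  proof eventually_elim
    case (elim n)
    let ?y = "real n *\<^sub>R x"
    let ?T = "real (passage_time X 0 (floor_site ?y))"
    have "real n * f x = f ?y" by (simp add: homogeneous)
    also have "\<dots> \<le> f (site_vec (floor_site ?y)) + l1norm (?y - site_vec (floor_site ?y))"
      using triangle[of "site_vec (floor_site ?y)" "?y - site_vec (floor_site ?y)"]
        upper[of "?y - site_vec (floor_site ?y)"] by simp
    also have "l1norm (?y - site_vec (floor_site ?y)) \<le> ?d"
      using floor_site_error[of ?y] by (simp add: l1norm_minus_commute)
    also have "f (site_vec (floor_site ?y)) \<le> (1 + \<theta>) * ?T + K" by (rule K)
    finally have "real n * f x \<le> (1 + \<theta>) * ?T + (K + ?d)" by simp
    then have "f x \<le> ((1 + \<theta>) * ?T + (K + ?d)) / real n"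
      using elim by (simp add: pos_le_divide_eq mult.commute)
    also have "\<dots> = (1 + \<theta>) * (?T / real n) + (K + ?d) / real n"
      by (simp add: add_divide_distrib)
    finally show ?case using elim by linarith
  qed
qed

lemma lower_bound_own_law:
  fixes P :: "nat pmf"
  assumes "equivalent_gauge (rate P :: real ^ 'n::finite \<Rightarrow> real) c" and "\<theta> > 0"
  shows "AE X in color_law P. \<exists>K. \<forall>w :: int ^ 'n.
    rate P (site_vec w) \<le> (1 + \<theta>) * real (passage_time X 0 w) + K"
proof -
  interpret equivalent_gauge "rate P :: real ^ 'n \<Rightarrow> real" c by (rule assms(1))
  obtain M \<epsilon> where "\<epsilon> > 0" and low:
    "\<And>N Q. N \<ge> 1 \<Longrightarrow> measure (color_law Q) {X. \<not> good_cell (rate P) N M X (0 :: int ^ 'n)} \<le> \<epsilon> \<Longrightarrow>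
      AE X in color_law Q. \<exists>K. \<forall>w :: int ^ 'n.
        rate P (site_vec w) \<le> (1 + \<theta>) * real (passage_time X 0 w) + K"
    by (rule lower_bound[OF \<open>\<theta> > 0\<close>]) (rule that)
  have "\<forall>\<^sub>F N in sequentially.
      measure (color_law P) {X. \<not> good_cell (rate P) N M X (0 :: int ^ 'n)} < \<epsilon> \<and> N \<ge> 1"
    using order_tendstoD(2)[OF prob_bad_cell_tendsto_0 \<open>\<epsilon> > 0\<close>] eventually_ge_at_top[of 1]
    by (rule eventually_conj)
  then obtain N where "measure (color_law P) {X. \<not> good_cell (rate P) N M X (0 :: int ^ 'n)} < \<epsilon>" "N \<ge> 1"
    by (auto simp: eventually_sequentially)
  then show ?thesis by (intro low) auto
qed

text \<open>
  The upper tail and the lower bounds with \<open>\<theta> = 1 / (k + 1)\<close>, for all \<open>k\<close> on a common event of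
  probability \<open>1\<close>, enclose the limit.
\<close>

lemma time_constant_eq_rate:
  fixes s :: "real ^ 'n::finite \<Rightarrow> int ^ 'n"
  assumes s: "nearest_site_rule s"
    and gauge: "equivalent_gauge (rate (embed_pmf p) :: real ^ 'n \<Rightarrow> real) c"
  shows "time_constant s p x = rate (embed_pmf p) x"
proof (rule time_constant_eqI[OF s])
  let ?P = "embed_pmf p"
  let ?r = "rate ?P x"
  have "AE X in color_law ?P. \<forall>k. \<exists>K. \<forall>w :: int ^ 'n.
      rate ?P (site_vec w) \<le> (1 + inverse (real (Suc k))) * real (passage_time X 0 w) + K"
    unfolding AE_all_countable by (intro allI lower_bound_own_law[OF gauge]) simp
  with upper_tail[where P = ?P and x = x]
  show "AE X in coloring_law p.
      (\<lambda>n. real (passage_time X 0 (floor_site (real n *\<^sub>R x))) / real n) \<longlonglongrightarrow> ?r"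
    unfolding coloring_law_def
  proof eventually_elim
    case (elim X)
    let ?t = "\<lambda>n. real (passage_time X 0 (floor_site (real n *\<^sub>R x))) / real n"
    show ?case
    proof (rule order_tendstoI)
      fix a assume "?r < a"
      then have "\<forall>\<^sub>F n in sequentially.
          real (passage_time X 0 (floor_site (real n *\<^sub>R x))) \<le> real n * (?r + (a - ?r) / 2)"
        using elim(1) by simp
      then show "\<forall>\<^sub>F n in sequentially. ?t n < a"
        using eventually_gt_at_top[of 0]
      proof eventually_elim
        case (elim n)
        then have "?t n \<le> ?r + (a - ?r) / 2"
          by (simp add: pos_divide_le_eq mult.commute)
        also have "\<dots> < a" using \<open>?r < a\<close> by (simp add: field_simps)
        finally show ?case .
      qed
    next
      fix a assume "a < ?r"
      define \<eta> where "\<eta> = (?r - a) / 2"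
      have "\<eta> > 0" using \<open>a < ?r\<close> by (simp add: \<eta>_def)
      obtain k where k: "inverse (real (Suc k)) * max 0 a < \<eta>"
      proof -
        have "0 < \<eta> / (max 0 a + 1)" using \<open>\<eta> > 0\<close> by simp
        then obtain k where "inverse (real (Suc k)) < \<eta> / (max 0 a + 1)"
          using reals_Archimedean by blast
        then have "inverse (real (Suc k)) * (max 0 a + 1) < \<eta>"
          by (simp add: pos_less_divide_eq)
        then have "inverse (real (Suc k)) * max 0 a < \<eta>"
          by (smt (verit) distrib_left inverse_nonnegative_iff_nonnegative mult_cancel_left1 of_nat_0_le_iff)
        then show thesis by (rule that)
      qed
      let ?\<theta> = "inverse (real (Suc k))"
      obtain K where K: "\<And>w :: int ^ 'n. rate ?P (site_vec w) \<le> (1 + ?\<theta>) * real (passage_time X 0 w) + K"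
        using elim(2) by blast
      have "\<forall>\<^sub>F n in sequentially. ?r \<le> (1 + ?\<theta>) * ?t n + \<eta>"
        by (rule lower_tail_from_lower_bound[OF gauge _ K \<open>\<eta> > 0\<close>]) simp
      then show "\<forall>\<^sub>F n in sequentially. a < ?t n"
      proof eventually_elim
        case (elim n)
        show ?case
        proof (rule ccontr)
          assume "\<not> a < ?t n"
          moreover have "?t n \<ge> 0" by simp
          ultimately have "(1 + ?\<theta>) * ?t n \<le> (1 + ?\<theta>) * max 0 a"
            by (intro mult_left_mono) auto
          moreover have "a \<ge> 0"
            using \<open>\<not> a < ?t n\<close> \<open>?t n \<ge> 0\<close> by linarith
          ultimately have "?r < a + \<eta> + \<eta>"
            using elim k by (simp add: distrib_right)
          then show False by (simp add: \<eta>_def)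
        qed
      qed
    qed
  qed
qed

section \<open>Semicontinuity of the rate\<close>

text \<open>
  The rate is an infimum of expectations, each of which is approximated from above by one that
  involves finitely many paths.
\<close>

lemma rate_usc:
  fixes x :: "real ^ 'n::finite"
  assumes p: "p \<in> color_simplex" and "\<eta> > 0"
  shows "\<forall>\<^sub>F q in at p within color_simplex. rate (embed_pmf q) x < rate (embed_pmf p) x + \<eta>"
proof -
  let ?P = "embed_pmf p" and ?d = "real CARD('n)"
  have "\<forall>\<^sub>F n in sequentially. padded_mean ?P (real n *\<^sub>R x) / real n < rate ?P x + \<eta> / 3 \<and> n \<ge> 1"
    using \<open>\<eta> > 0\<close> by (intro eventually_conj eventually_ge_at_top order_tendstoD(2)[OF rate_limit]) simp
  then obtain n where n: "padded_mean ?P (real n *\<^sub>R x) / real n < rate ?P x + \<eta> / 3" "n \<ge> 1"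
    by (auto simp: eventually_sequentially)
  define v where "v = floor_site (real n *\<^sub>R x)"
  have "\<eta> / 3 > 0" using \<open>\<eta> > 0\<close> by simp
  then obtain \<Gamma> where \<Gamma>: "finite \<Gamma>" "\<Gamma> \<noteq> {}" "\<Gamma> \<subseteq> paths 0 v"
    "(\<integral>X. real (best_time X \<Gamma>) \<partial>color_law ?P) < mean_time ?P v + \<eta> / 3"
    using finitely_many_paths_suffice by blast
  obtain C where C: "\<And>X. best_time X \<Gamma> \<le> C"
    using best_time_bounded[OF \<Gamma>(1,2)] by blast
  define f where "f X = real C - real (best_time X \<Gamma>)" for X
  have f_int: "(\<integral>X. f X \<partial>coloring_law q) = real C - (\<integral>X. real (best_time X \<Gamma>) \<partial>color_law (embed_pmf q))" for q
    unfolding f_def coloring_law_def using integrable_best_time[OF \<Gamma>(1,2)]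
    by (subst Bochner_Integration.integral_diff) simp_all
  have "\<forall>\<^sub>F q in at p within color_simplex.
      (\<integral>X. f X \<partial>coloring_law p) - \<eta> / 3 < (\<integral>X. f X \<partial>coloring_law q)"
  proof (rule expectation_lsc[OF _ _ _ _ _ p \<open>\<eta> / 3 > 0\<close>])
    show "f \<in> borel_measurable (color_law P)" for P
      unfolding f_def using measurable_best_time[OF \<Gamma>(1,2)] by simp
    show "0 \<le> f X" "f X \<le> real C" for X using C[of X] by (simp_all add: f_def)
    show "finite (\<Union>\<gamma>\<in>\<Gamma>. set \<gamma>)" using \<Gamma>(1) by simp
    show "depends_on (\<Union>\<gamma>\<in>\<Gamma>. set \<gamma>) f"
      using depends_on_best_time[of \<Gamma>] unfolding depends_on_def f_def by metis
  qed
  then show ?thesis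
  proof eventually_elim
    case (elim q)
    let ?Q = "embed_pmf q"
    have "mean_time ?Q v \<le> (\<integral>X. real (best_time X \<Gamma>) \<partial>color_law ?Q)"
      unfolding mean_time_def using passage_time_le_best_time[OF \<Gamma>(1-3)]
      by (intro integral_mono integrable_best_time \<Gamma> integrable_passage_time) simp
    also have "\<dots> < mean_time ?P v + \<eta> / 3 + \<eta> / 3"
      using elim \<Gamma>(4) by (simp add: f_int)
    finally have "padded_mean ?Q (real n *\<^sub>R x) \<le> padded_mean ?P (real n *\<^sub>R x) + 2 * \<eta> / 3"
      by (simp add: padded_mean_def v_def)
    then have "padded_mean ?Q (real n *\<^sub>R x) / real n \<le> (padded_mean ?P (real n *\<^sub>R x) + 2 * \<eta> / 3) / real n"
      by (intro divide_right_mono) auto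
    also have "\<dots> = padded_mean ?P (real n *\<^sub>R x) / real n + (2 * \<eta> / 3) / real n"
      by (rule add_divide_distrib)
    also have "(2 * \<eta> / 3) / real n \<le> 2 * \<eta> / 3"
      using n(2) \<open>\<eta> > 0\<close> by (simp add: divide_le_eq)
    finally show ?case
      using n(1) rate_le[OF n(2), of ?Q x] by linarith
  qed
qed

text \<open>
  All rates have the same Lipschitz constant, so it is enough to compare them on a finite net of the
  sphere; the additive error becomes a factor because the rate at \<open>p\<close> is at least \<open>c\<close> there.
\<close>

lemma rate_upper_semicontinuous_uniform:
  assumes p: "p \<in> color_simplex"
    and gauge: "equivalent_gauge (rate (embed_pmf p) :: real ^ 'n::finite \<Rightarrow> real) c" and "\<theta> > 0"
  shows "\<forall>\<^sub>F q in at p within color_simplex. \<forall>x :: real ^ 'n.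
    rate (embed_pmf q) x \<le> (1 + \<theta>) * rate (embed_pmf p) x"
proof -
  interpret equivalent_gauge "rate (embed_pmf p) :: real ^ 'n \<Rightarrow> real" c by (rule gauge)
  let ?P = "embed_pmf p" and ?d = "real CARD('n)"
  define \<rho> where "\<rho> = \<theta> * c / (2 * ?d + 1)"
  have "2 * ?d + 1 > 0" by simp
  then have "\<rho> > 0" "\<rho> * (2 * ?d + 1) = \<theta> * c"
    using \<open>\<theta> > 0\<close> c_pos by (simp_all add: \<rho>_def)
  obtain A where A: "finite A" "sphere (0 :: real ^ 'n) 1 \<subseteq> (\<Union>a\<in>A. ball a \<rho>)"
    using compact_sphere[of "0 :: real ^ 'n" 1] \<open>\<rho> > 0\<close>
    unfolding compact_eq_totally_bounded by blast
  have "\<forall>\<^sub>F q in at p within color_simplex. \<forall>a\<in>A. rate (embed_pmf q) a < rate ?P a + \<rho>"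
    using A(1) p \<open>\<rho> > 0\<close> by (intro eventually_ball_finite ballI rate_usc)
  then show ?thesis
  proof eventually_elim
    case (elim q)
    let ?Q = "embed_pmf q"
    have sphere: "rate ?Q x \<le> (1 + \<theta>) * rate ?P x" if "norm x = 1" for x :: "real ^ 'n"
    proof -
      have "x \<in> (\<Union>a\<in>A. ball a \<rho>)" using that by (intro subsetD[OF A(2)]) simp
      then obtain a where a: "a \<in> A" "norm (x - a) < \<rho>"
        by (auto simp: dist_norm norm_minus_commute)
      have "l1norm (x - a) \<le> ?d * norm (x - a)" by (rule l1norm_le_norm)
      also have "\<dots> \<le> ?d * \<rho>" using a(2) by (intro mult_left_mono) auto
      finally have xa: "l1norm (x - a) \<le> ?d * \<rho>" .
      have "rate ?Q x \<le> rate ?Q a + ?d * \<rho>"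
        using rate_lipschitz[of ?Q x a] xa by simp
      also have "rate ?Q a \<le> rate ?P a + \<rho>" using elim a(1) by auto
      also have "rate ?P a \<le> rate ?P x + ?d * \<rho>"
        using rate_lipschitz[of ?P a x] xa by (simp add: l1norm_minus_commute)
      finally have "rate ?Q x \<le> rate ?P x + \<rho> * (2 * ?d + 1)"
        by (simp add: algebra_simps)
      also have "\<dots> = rate ?P x + \<theta> * (c * 1)"
        using \<open>\<rho> * (2 * ?d + 1) = \<theta> * c\<close> by simp
      also have "\<dots> \<le> rate ?P x + \<theta> * rate ?P x"
      proof (intro add_left_mono mult_left_mono)
        have "c * 1 \<le> c * l1norm x"
          using norm_le_l1norm[of x] c_pos that by (intro mult_left_mono) auto
        also have "\<dots> \<le> rate ?P x" by (rule lower)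
        finally show "c * 1 \<le> rate ?P x" .
      qed (use \<open>\<theta> > 0\<close> in simp)
      finally show ?thesis by (simp add: distrib_right)
    qed
    show ?case
    proof
      fix x :: "real ^ 'n"
      show "rate ?Q x \<le> (1 + \<theta>) * rate ?P x"
      proof (cases "x = 0")
        case True
        then show ?thesis
          using rate_scale[of 0 ?P x] rate_scale[of 0 ?Q x] by simp
      next
        case False
        let ?e = "(1 / norm x) *\<^sub>R x"
        have "rate R x = norm x * rate R ?e" for R
          using False by (simp add: rate_scale)
        then show ?thesis
          using sphere[of ?e] False mult_left_mono[of "rate ?Q ?e" "(1 + \<theta>) * rate ?P ?e" "norm x"]
          by (simp add: mult_ac)
      qed
    qed
  qed
qed

text \<open>
  Fix \<open>N\<close> for which bad cells are rare at \<open>p\<close>; they remain rare at nearby \<open>q\<close>.  Under the law of \<open>q\<close> the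
  passage times are then bounded below through the rate at \<open>p\<close> and above through the rate at \<open>q\<close>.
\<close>

lemma rate_lower_semicontinuous_uniform:
  assumes p: "p \<in> color_simplex"
    and gauge: "equivalent_gauge (rate (embed_pmf p) :: real ^ 'n::finite \<Rightarrow> real) c" and "\<theta> > 0"
  shows "\<forall>\<^sub>F q in at p within color_simplex. \<forall>x :: real ^ 'n.
    rate (embed_pmf p) x \<le> (1 + \<theta>) * rate (embed_pmf q) x"
proof -
  let ?P = "embed_pmf p"
  interpret equivalent_gauge "rate ?P :: real ^ 'n \<Rightarrow> real" c by (rule gauge)
  obtain M \<epsilon> where "\<epsilon> > 0" and low:
    "\<And>N Q. N \<ge> 1 \<Longrightarrow> measure (color_law Q) {X. \<not> good_cell (rate ?P) N M X (0 :: int ^ 'n)} \<le> \<epsilon> \<Longrightarrow>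
      AE X in color_law Q. \<exists>K. \<forall>w :: int ^ 'n.
        rate ?P (site_vec w) \<le> (1 + \<theta>) * real (passage_time X 0 w) + K"
    by (rule lower_bound[OF \<open>\<theta> > 0\<close>]) (rule that)
  have "\<epsilon> / 2 > 0" using \<open>\<epsilon> > 0\<close> by simp
  have "\<forall>\<^sub>F N in sequentially.
      measure (color_law ?P) {X. \<not> good_cell (rate ?P) N M X (0 :: int ^ 'n)} < \<epsilon> / 2 \<and> N \<ge> 1"
    using order_tendstoD(2)[OF prob_bad_cell_tendsto_0 \<open>\<epsilon> / 2 > 0\<close>] eventually_ge_at_top[of 1]
    by (rule eventually_conj)
  then obtain N where N: "measure (color_law ?P) {X. \<not> good_cell (rate ?P) N M X (0 :: int ^ 'n)} < \<epsilon> / 2" "N \<ge> 1"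
    by (auto simp: eventually_sequentially)
  let ?G = "{X. good_cell (rate ?P) N M X (0 :: int ^ 'n)}"
  have compl: "measure (color_law Q) {X. \<not> good_cell (rate ?P) N M X (0 :: int ^ 'n)}
      = 1 - measure (color_law Q) ?G" for Q
    using color_law.prob_compl[OF measurable_good_cell[of "rate ?P" N M "0 :: int ^ 'n" Q]]
    by (simp add: Compl_eq_Diff_UNIV [symmetric] Collect_neg_eq)
  have "\<forall>\<^sub>F q in at p within color_simplex.
      (\<integral>X. indicator ?G X \<partial>coloring_law p) - \<epsilon> / 2 < (\<integral>X. (indicator ?G X :: real) \<partial>coloring_law q)"
  proof (rule expectation_lsc[OF _ _ _ finite_cell_box[OF N(2), of M] _ p \<open>\<epsilon> / 2 > 0\<close>])
    show "depends_on (cell_box N M 0) (indicator ?G :: _ \<Rightarrow> real)"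
      using depends_on_good_cell[of N M 0 "rate ?P"] unfolding depends_on_def indicator_def by auto
    show "(indicator ?G X :: real) \<le> 1" for X by (simp add: indicator_def)
  qed (use measurable_good_cell in auto)
  then show ?thesis
  proof eventually_elim
    case (elim q)
    let ?Q = "embed_pmf q"
    have "measure (color_law ?P) ?G - \<epsilon> / 2 < measure (color_law ?Q) ?G"
      using elim by (simp add: coloring_law_def)
    then have "measure (color_law ?Q) {X. \<not> good_cell (rate ?P) N M X (0 :: int ^ 'n)} \<le> \<epsilon>"
      using N(1) by (simp add: compl)
    note AE_low = low[OF N(2) this]
    show ?case
    proof
      fix x :: "real ^ 'n"
      have "rate ?P x \<le> (1 + \<theta>) * (rate ?Q x + \<eta>) + \<eta>" if "\<eta> > 0" for \<eta>
      proof -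
        have "AE X in (color_law ?Q :: (int ^ 'n \<Rightarrow> nat) measure). rate ?P x \<le> (1 + \<theta>) * (rate ?Q x + \<eta>) + \<eta>"
          using AE_low upper_tail[where P = ?Q and x = x]
        proof eventually_elim
          case (elim X)
          obtain K where K: "\<And>w :: int ^ 'n. rate ?P (site_vec w) \<le> (1 + \<theta>) * real (passage_time X 0 w) + K"
            using elim(1) by blast
          have "\<forall>\<^sub>F n in sequentially. rate ?P x \<le> (1 + \<theta>) * (rate ?Q x + \<eta>) + \<eta>"
            using lower_tail_from_lower_bound[OF gauge \<open>\<theta> > 0\<close> K that, of x]
              elim(2)[rule_format, OF that] eventually_gt_at_top[of 0]
          proof eventually_elim
            case (elim n)
            let ?t = "real (passage_time X 0 (floor_site (real n *\<^sub>R x))) / real n"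
            have "?t \<le> rate ?Q x + \<eta>"
              using elim(2,3) by (simp add: pos_divide_le_eq mult.commute)
            then have "(1 + \<theta>) * ?t \<le> (1 + \<theta>) * (rate ?Q x + \<eta>)"
              using \<open>\<theta> > 0\<close> by (intro mult_left_mono) auto
            then show ?case using elim(1) by linarith
          qed
          then show ?case by simp
        qed
        then show ?thesis by simp
      qed
      note * = this
      show "rate ?P x \<le> (1 + \<theta>) * rate ?Q x"
      proof (rule field_le_epsilon)
        fix e :: real assume "e > 0"
        define \<eta> where "\<eta> = e / (2 + \<theta>)"
        have "\<eta> > 0" "(2 + \<theta>) * \<eta> = e"
          using \<open>e > 0\<close> \<open>\<theta> > 0\<close> by (simp_all add: \<eta>_def)
        then show "rate ?P x \<le> (1 + \<theta>) * rate ?Q x + e"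
          using *[of \<eta>] by (simp add: algebra_simps)
      qed
    qed
  qed
qed

section \<open>Continuity of the asymptotic shape\<close>

lemma hausdorff_dist_le:
  assumes "\<And>y. y \<in> B \<Longrightarrow> \<exists>x\<in>A. dist x y \<le> e" "\<And>x. x \<in> A \<Longrightarrow> \<exists>y\<in>B. dist x y \<le> e"
  shows "hausdorff_dist A B \<le> ennreal e"
  unfolding hausdorff_dist_def
proof (intro max.boundedI SUP_least)
  fix y assume "y \<in> B"
  then obtain x where "x \<in> A" "dist x y \<le> e" using assms(1) by blast
  then show "(INF x\<in>A. ennreal (dist x y)) \<le> ennreal e"
    by (intro INF_lower2[of x]) (auto simp: ennreal_leI)
next
  fix x assume "x \<in> A"
  then obtain y where "y \<in> B" "dist x y \<le> e" using assms(2) by blast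
  then show "(INF y\<in>B. ennreal (dist x y)) \<le> ennreal e"
    by (intro INF_lower2[of y]) (auto simp: ennreal_leI)
qed

text \<open>
  Shrinking by \<open>1 + \<theta>\<close> maps each of the balls into the other and moves a point by at most \<open>\<theta>\<close> times the
  norm of its image.
\<close>

lemma hausdorff_dist_unit_balls:
  fixes f g :: "'a::real_normed_vector \<Rightarrow> real"
  assumes f: "\<And>t x. t \<ge> 0 \<Longrightarrow> f (t *\<^sub>R x) = t * f x" and g: "\<And>t x. t \<ge> 0 \<Longrightarrow> g (t *\<^sub>R x) = t * g x"
    and fg: "\<And>x. f x \<le> (1 + \<theta>) * g x" and gf: "\<And>x. g x \<le> (1 + \<theta>) * f x"
    and "\<theta> > 0" and bound: "\<And>x. f x \<le> 1 \<Longrightarrow> norm x \<le> R"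
  shows "hausdorff_dist {x. f x \<le> 1} {x. g x \<le> 1} \<le> ennreal (\<theta> * R)"
proof -
  define t where "t = 1 / (1 + \<theta>)"
  have t: "t \<ge> 0" "(1 + \<theta>) * t = 1"
    using \<open>\<theta> > 0\<close> by (simp_all add: t_def)
  have shrink: "dist x (t *\<^sub>R x) \<le> \<theta> * norm (t *\<^sub>R x)" for x :: 'a
  proof -
    have "x - t *\<^sub>R x = \<theta> *\<^sub>R (t *\<^sub>R x)"
      using t(2) by (metis add_diff_cancel_left' distrib_right mult_1 scaleR_left_diff_distrib scaleR_one scaleR_scaleR)
    then show ?thesis using \<open>\<theta> > 0\<close> by (simp add: dist_norm abs_mult)
  qed
  show ?thesis
  proof (rule hausdorff_dist_le)
    fix y assume "y \<in> {x. g x \<le> 1}"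
    then have "(1 + \<theta>) * t * g y \<le> 1" by (simp add: t)
    then have "f (t *\<^sub>R y) \<le> 1"
      using fg[of "t *\<^sub>R y"] g[OF t(1), of y] by (simp add: mult.assoc)
    moreover from this have "dist (t *\<^sub>R y) y \<le> \<theta> * R"
      using shrink[of y] bound[of "t *\<^sub>R y"] \<open>\<theta> > 0\<close>
      by (subst dist_commute) (meson less_imp_le mult_left_mono order_trans)
    ultimately show "\<exists>x\<in>{x. f x \<le> 1}. dist x y \<le> \<theta> * R" by blast
  next
    fix x assume x: "x \<in> {x. f x \<le> 1}"
    then have "(1 + \<theta>) * t * f x \<le> 1" by (simp add: t)
    then have "g (t *\<^sub>R x) \<le> 1"
      using gf[of "t *\<^sub>R x"] f[OF t(1), of x] by (simp add: mult.assoc)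
    moreover have "dist x (t *\<^sub>R x) \<le> \<theta> * R"
    proof -
      have "t \<le> 1" using \<open>\<theta> > 0\<close> by (simp add: t_def)
      then have "norm (t *\<^sub>R x) \<le> 1 * norm x"
        unfolding norm_scaleR using t(1) by (intro mult_right_mono) auto
      also have "\<dots> \<le> R" using bound x by simp
      finally show ?thesis
        using shrink[of x] \<open>\<theta> > 0\<close> by (meson less_imp_le mult_left_mono order_trans)
    qed
    ultimately show "\<exists>y\<in>{x. g x \<le> 1}. dist x y \<le> \<theta> * R" by blast
  qed
qed

lemma compact_shape_imp_rate_nonzero:
  fixes s :: "real ^ 'n::finite \<Rightarrow> int ^ 'n" and x :: "real ^ 'n"
  assumes s: "nearest_site_rule s" and "compact (asymptotic_shape s p)" and "x \<noteq> 0"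
  shows "rate (embed_pmf p) x \<noteq> 0"
proof
  assume zero: "rate (embed_pmf p) x = 0"
  obtain R where R: "\<And>y. y \<in> asymptotic_shape s p \<Longrightarrow> norm y \<le> R"
    using compact_imp_bounded[OF assms(2)] by (auto simp: bounded_iff)
  define t where "t = (\<bar>R\<bar> + 1) / norm x"
  have "t \<ge> 0" by (simp add: t_def)
  then have "time_constant s p (t *\<^sub>R x) = 0"
    using zero by (intro time_constant_zero[OF s]) (simp add: rate_scale)
  then have "norm (t *\<^sub>R x) \<le> R"
    by (intro R) (simp add: asymptotic_shape_def)
  then show False
    using \<open>x \<noteq> 0\<close> by (simp add: t_def)
qed

theorem theorem2p4:
  fixes s :: "real ^ 'n::finite \<Rightarrow> int ^ 'n" and p :: "nat \<Rightarrow> real"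
  assumes "CARD('n) \<ge> 2"
    and "nearest_site_rule s"
    and "p \<in> color_simplex"
    and "compact (asymptotic_shape s p)"
  shows "((\<lambda>q. hausdorff_dist (asymptotic_shape s p) (asymptotic_shape s q)) \<longlongrightarrow> 0)
           (at p within color_simplex)"
proof -
  note s = assms(2) and p = assms(3)
  obtain c where gauge: "equivalent_gauge (rate (embed_pmf p) :: real ^ 'n \<Rightarrow> real) c"
    using rate_gauge compact_shape_imp_rate_nonzero[OF s assms(4)] by metis
  have shape: "asymptotic_shape s r = {x. rate (embed_pmf r) x \<le> 1}"
    if "equivalent_gauge (rate (embed_pmf r) :: real ^ 'n \<Rightarrow> real) c'" for r c'
    using time_constant_eq_rate[OF s that] by (simp add: asymptotic_shape_def)
  obtain R where R: "R > 0" "\<And>x. x \<in> asymptotic_shape s p \<Longrightarrow> norm x \<le> R"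
    using compact_imp_bounded[OF assms(4)] by (auto simp: bounded_pos)
  have close: "\<forall>\<^sub>F q in at p within color_simplex.
      hausdorff_dist (asymptotic_shape s p) (asymptotic_shape s q) \<le> ennreal e" if "e > 0" for e
  proof -
    define \<theta> where "\<theta> = e / R"
    have "\<theta> > 0" using that R(1) by (simp add: \<theta>_def)
    show ?thesis
      using rate_lower_semicontinuous_uniform[OF p gauge \<open>\<theta> > 0\<close>]
        rate_upper_semicontinuous_uniform[OF p gauge \<open>\<theta> > 0\<close>]
    proof eventually_elim
      case (elim q)
      have "rate (embed_pmf q) x \<noteq> 0" if "x \<noteq> 0" for x :: "real ^ 'n"
      proof
        assume "rate (embed_pmf q) x = 0"
        then have "rate (embed_pmf p) x = 0"
          using elim(1)[rule_format, of x] rate_nonneg[of "embed_pmf p" x] by simp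
        then show False
          using compact_shape_imp_rate_nonzero[OF s assms(4) that] by simp
      qed
      then obtain c' where gauge_q: "equivalent_gauge (rate (embed_pmf q) :: real ^ 'n \<Rightarrow> real) c'"
        using rate_gauge by blast
      have "hausdorff_dist {x :: real ^ 'n. rate (embed_pmf p) x \<le> 1} {x. rate (embed_pmf q) x \<le> 1}
          \<le> ennreal (\<theta> * R)"
        using elim \<open>\<theta> > 0\<close> R(2)
        by (intro hausdorff_dist_unit_balls rate_scale) (auto simp: shape[OF gauge])
      then show ?case
        using R(1) by (simp add: shape[OF gauge] shape[OF gauge_q] \<theta>_def)
    qed
  qed
  show ?thesis
  proof (rule order_tendstoI)
    fix a :: ennreal assume "0 < a"
    then obtain e where e: "e > 0" "ennreal e < a"
    proof (cases a)
      case (real r)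
      then have "r / 2 > 0" "ennreal (r / 2) < a"
        using \<open>0 < a\<close> by (auto simp: ennreal_less_iff)
      then show thesis by (rule that)
    next
      case top
      then show thesis by (intro that[of 1]) auto
    qed
    show "\<forall>\<^sub>F q in at p within color_simplex.
        hausdorff_dist (asymptotic_shape s p) (asymptotic_shape s q) < a"
      using close[OF e(1)] by eventually_elim (use e(2) in \<open>auto intro: le_less_trans\<close>)
  qed simp
qed

end
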